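(* Let $f \in L^2(\Omega)$. Then: 1. If $\varepsilon \sim c N^{\alpha}$ for some $0 < \alpha < 1$ and $c > 0$ as $N \rightarrow \infty$, then $$E_{N,\tau}(f) \lesssim \tau \sqrt{T \varepsilon / N}\; e^{\pi^2/(4 T^2)} \|f\|_{L^2(\Omega)} + o(1),\quad N \rightarrow \infty.$$ In particular, $E_{N,\tau}(f) \rightarrow 0$ as $N \rightarrow \infty$. 2. If $\varepsilon \sim c N$ as $N \rightarrow \infty$ for some $c > 0$, then $$E_{N,\tau}(f) \lesssim \left ( \frac{1}{\sqrt{e^{\pi^2 / (2 c^2 T^2)} - 1}} + \sqrt{c T}\, \tau \right ) e^{\pi^2 / (4 T^2)} \|f\|_{L^2(\Omega)} + o(1),\quad N \rightarrow \infty.$$ In particular, if $\tau < 1/2$ and $c$ satisfies $$c T \leq \frac{\pi}{\sqrt{2 \log(1+\tau^{-2})}},$$ then, as $N \rightarrow \infty$, $$E_{N,\tau}(f) \lesssim \tau\, e^{\pi^2 / (4 T^2)} \|f\|_{L^2(\Omega)} + o(1).$$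
   Context: Setting. Let $T>0$ and let $\Omega \subset (-T,T)$ be a (one-dimensional) domain of positive measure; put $B = \max_{x\in\Omega}|x|$, so $B<T$. Let $\tau>0$ be a fixed (regularization) parameter and let $\phi(r)=e^{-r^2}$ be the Gaussian radial basis function. For a positive integer $N$ and a shape parameter $\varepsilon>0$ define the synthesis operator on coefficient vectors $z=(z_n)_{n=-N}^{N}\in\mathbb{C}^{2N+1}$ by $$\mathcal{T}_N z = \sum_{n=-N}^{N} z_n \sqrt{\varepsilon}\,\phi\big(\varepsilon(\cdot - nT/N)\big),$$ and, for $f\in L^2(\Omega)$, define $$E_{N,\tau}(f) = \inf_{z\in\mathbb{C}^{2N+1}} \left\{ \|f-\mathcal{T}_N z\|_{L^2(\Omega)} + \tau \|z\|_{\ell^2}\right\}.$$ In the theorem $\varepsilon=\varepsilon(N)>0$ depends on $N$; $\varepsilon\sim cN^{\alpha}$ means $\varepsilon(N)/(cN^\alpha)\to 1$ as $N\to\infty$ (and similarly $\varepsilon\sim cN$). Notation. $X\lesssim Y + o(1)$ means $X\le C\,Y + r_N$ with an absolute constant $C>0$ (independent of $N$, $\varepsilon$, $\tau$, $f$, $c$, $\alpha$, $T$, $\Omega$) and a sequence $r_N\to0$ as $N\to\infty$ for fixed $f,\tau,T,\Omega$ and fixed function $N\mapsto\varepsilon(N)$. *)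

theory Defs
  imports "HOL-Analysis.Analysis" "HOL-Library.Landau_Symbols"
begin

text \<open>Elements of \<open>L\<^sup>2(\<Omega>)\<close> are handled through representatives.\<close>

definition square_integrable :: "real set \<Rightarrow> (real \<Rightarrow> complex) \<Rightarrow> bool" where
  "square_integrable \<Omega> f \<longleftrightarrow>
     f \<in> borel_measurable (lebesgue_on \<Omega>) \<and>
     integrable (lebesgue_on \<Omega>) (\<lambda>x. (cmod (f x))\<^sup>2)"

definition L2_norm :: "real set \<Rightarrow> (real \<Rightarrow> complex) \<Rightarrow> real" where
  "L2_norm \<Omega> f = sqrt (LINT x|lebesgue_on \<Omega>. (cmod (f x))\<^sup>2)"

definition gauss_rbf :: "real \<Rightarrow> real" where
  "gauss_rbf r = exp (- r\<^sup>2)"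

text \<open>
  A coefficient vector in \<open>\<complex>\<close> to the power \<open>2N+1\<close> is a function \<open>z :: int \<Rightarrow> complex\<close> of which
  only the entries with index in \<open>{-N..N}\<close> are ever used, both in the operator and in the norm.
\<close>

definition synthesis :: "real \<Rightarrow> real \<Rightarrow> nat \<Rightarrow> (int \<Rightarrow> complex) \<Rightarrow> real \<Rightarrow> complex" where
  "synthesis T \<epsilon> N z x =
     (\<Sum>n\<in>{- int N..int N}.
        z n * complex_of_real (sqrt \<epsilon> * gauss_rbf (\<epsilon> * (x - of_int n * T / real N))))"

definition coeff_norm :: "nat \<Rightarrow> (int \<Rightarrow> complex) \<Rightarrow> real" where
  "coeff_norm N z = L2_set (\<lambda>n. cmod (z n)) {- int N..int N}"

definition reg_error ::
  "real \<Rightarrow> real set \<Rightarrow> real \<Rightarrow> real \<Rightarrow> nat \<Rightarrow> (real \<Rightarrow> complex) \<Rightarrow> real" where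
  "reg_error T \<Omega> \<tau> \<epsilon> N f =
     (INF z. L2_norm \<Omega> (\<lambda>x. f x - synthesis T \<epsilon> N z x) + \<tau> * coeff_norm N z)"

text \<open>
  The relation \<open>X \<lesssim> Y + o(1)\<close> with the implied constant \<open>C\<close> made explicit, so that it can be
  quantified before all other parameters; the remainder may depend on the sequences.
\<close>

definition le_upto_o1 :: "real \<Rightarrow> (nat \<Rightarrow> real) \<Rightarrow> (nat \<Rightarrow> real) \<Rightarrow> bool" where
  "le_upto_o1 C X Y \<longleftrightarrow>
     (\<exists>r :: nat \<Rightarrow> real. r \<in> o(\<lambda>_. 1) \<and> (\<forall>N\<ge>1. X N \<le> C * Y N + r N))"

end

theory Submission
  imports Defs "HOL-Complex_Analysis.Complex_Analysis" "HOL-Probability.Distributions"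
    "HOL-Real_Asymp.Real_Asymp"
begin

text \<open>
  Write \<open>h = T / N\<close> for the mesh size and \<open>a = \<epsilon> h\<close>. The infimum is bounded by an explicit
  choice of coefficients, those of the Gaussian quasi-interpolant
  \<open>x \<mapsto> a / sqrt \<pi> * (\<Sum>n. g (n h) exp (- (\<epsilon> (x - n h))\<^sup>2))\<close> of a continuous function \<open>g\<close> that
  vanishes outside \<open>(-T, T)\<close> and is close to \<open>f\<close> in the \<open>L\<^sup>2\<close> norm.

  Since \<open>g\<close> is uniformly continuous and \<open>\<epsilon>\<close> tends to infinity, each Gaussian sees \<open>g\<close> as locally
  constant: up to a uniformly vanishing error the quasi-interpolant is \<open>g\<close> times the
  quasi-interpolant of the constant \<open>1\<close>, which is a theta function. By
  \<open>gauss_lattice_sum_approx\<close> the latter differs from \<open>1\<close> by at most about \<open>2 q\<close>, where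
  \<open>q = exp (- \<pi>\<^sup>2 / a\<^sup>2)\<close>; this is obtained by contour integration. The squared norm of the coefficients
  is a Riemann sum for \<open>a / \<pi>\<close> times the squared norm of \<open>g\<close>. Together, for fixed \<open>g\<close>,
  the error is asymptotically at most \<open>(2 q / (1 - q\<^sup>2) + \<tau> sqrt a)\<close> times the norm of \<open>f\<close>, up to
  the distance of \<open>g\<close> to \<open>f\<close>; this is \<open>reg_error_eventually_le\<close>.

  If \<open>\<epsilon>\<close> grows like a positive power of \<open>N\<close> below the first, then \<open>a\<close> tends to \<open>0\<close> and so do \<open>q\<close>
  and the error itself (\<open>reg_error_tendsto_0\<close>), which makes the asserted bound immediate. If
  \<open>\<epsilon> \<sim> c N\<close>, then \<open>a\<close> tends to \<open>c T\<close>, and \<open>q\<close> is far smaller than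
  \<open>1 / sqrt (exp (\<pi>\<^sup>2 / (2 c\<^sup>2 T\<^sup>2)) - 1)\<close> unless \<open>c T\<close> is large; in the latter case this
  quantity is at least \<open>1\<close> and the zero vector of coefficients is good enough
  (\<open>reg_error_critical_rate\<close>).
\<close>

section \<open>Sums of Gaussians over the integers\<close>

lemma contour_integral_linepath_same_Im:
  assumes "a < b"
  shows "contour_integral (linepath (Complex a y) (Complex b y)) f = integral {a..b} (\<lambda>x. f (Complex x y))"
proof -
  have "contour_integral (linepath (Complex a y) (Complex b y)) f =
      (Complex b y - Complex a y) * integral {0..1} (\<lambda>x. f (linepath (Complex a y) (Complex b y) x))"
    by (simp add: contour_integral_integral)
  also have "Complex b y - Complex a y = of_real (b - a)"
    by (simp add: Complex_eq algebra_simps)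
  also have "integral {0..1} (\<lambda>x. f (linepath (Complex a y) (Complex b y) x)) =
      integral {0..(b - a) / (b - a)} (\<lambda>x. f (Complex (a + (b - a) * x) y))"
    using assms by (simp add: linepath_def Complex_eq scaleR_conv_of_real algebra_simps)
  also have "{0..(b - a) / (b - a)} = (\<lambda>x. x / (b - a)) ` {0..b - a}"
    using assms by simp
  also have "integral \<dots> (\<lambda>x. f (Complex (a + (b - a) * x) y)) =
      integral {a-a..b-a} (\<lambda>x. f (Complex (x + a) y)) / of_real (b - a)"
    using assms by (subst integral_stretch_real) (auto simp: scaleR_conv_of_real add_ac)
  also have "\<dots> = integral {a..b} (\<lambda>x. f (Complex x y)) / of_real (b - a)"
    by (subst integral_shift_real_ivl) (rule refl)
  finally show ?thesis
    using assms by simp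
qed

lemma
  fixes a t :: real
  assumes "a > 0"
  shows gauss_integrable: "integrable lborel (\<lambda>x. exp (- (a * (x - t))\<^sup>2))"
    and gauss_integral: "(LINT x|lborel. exp (- (a * (x - t))\<^sup>2)) = sqrt pi / a"
proof -
  define \<sigma> where "\<sigma> = 1 / (sqrt 2 * a)"
  have \<sigma>: "\<sigma> > 0" using assms by (simp add: \<sigma>_def)
  have "normal_density t \<sigma> x = (a / sqrt pi) * exp (- (a * (x - t))\<^sup>2)" for x
    using assms by (simp add: normal_density_def \<sigma>_def power_mult_distrib real_sqrt_mult real_sqrt_divide divide_simps)
  hence eq: "(\<lambda>x. exp (- (a * (x - t))\<^sup>2)) = (\<lambda>x. (sqrt pi / a) * normal_density t \<sigma> x)"
    using assms by (simp add: fun_eq_iff)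
  show "integrable lborel (\<lambda>x. exp (- (a * (x - t))\<^sup>2))"
    unfolding eq using \<sigma> by (intro integrable_mult_right) simp
  show "(LINT x|lborel. exp (- (a * (x - t))\<^sup>2)) = sqrt pi / a"
    unfolding eq using \<sigma> by simp
qed

lemma gauss_integral_interval_le:
  fixes a t :: real
  assumes "a > 0"
  shows "integral {u..v} (\<lambda>x. exp (- (a * (x - t))\<^sup>2)) \<le> sqrt pi / a"
proof -
  have "integral {u..v} (\<lambda>x. exp (- (a * (x - t))\<^sup>2)) \<le> integral UNIV (\<lambda>x. exp (- (a * (x - t))\<^sup>2))"
    using has_integral_integral_lborel[OF gauss_integrable[OF assms, of t]]
    by (intro integral_subset_le integrable_continuous_real continuous_intros)
       (auto simp: integrable_on_def)
  also have "\<dots> = sqrt pi / a"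
    using has_integral_integral_lborel[OF gauss_integrable[OF assms, of t]] gauss_integral[OF assms, of t]
    by (simp add: integral_unique)
  finally show ?thesis .
qed

lemma gauss_integral_interval_tendsto:
  fixes a t :: real
  assumes "a > 0"
  shows "(\<lambda>M. integral {- (real M + 1/2)..real M + 1/2} (\<lambda>x. exp (- (a * (x - t))\<^sup>2))) \<longlonglongrightarrow> sqrt pi / a"
proof -
  let ?g = "\<lambda>x::real. exp (- (a * (x - t))\<^sup>2)"
  have "(\<lambda>M. LINT x|lborel. indicator {- (real M + 1/2)..real M + 1/2} x *\<^sub>R ?g x) \<longlonglongrightarrow> (LINT x|lborel. ?g x)"
  proof (rule integral_dominated_convergence[where w = ?g])
    show "AE x in lborel. (\<lambda>M. indicator {- (real M + 1/2)..real M + 1/2} x *\<^sub>R ?g x) \<longlonglongrightarrow> ?g x"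
    proof (intro AE_I2 tendsto_eventually)
      fix x :: real
      have "\<forall>\<^sub>F M in sequentially. real M \<ge> \<bar>x\<bar>"
        using filterlim_real_sequentially by (simp add: filterlim_at_top)
      thus "\<forall>\<^sub>F M in sequentially. indicator {- (real M + 1/2)..real M + 1/2} x *\<^sub>R ?g x = ?g x"
        by eventually_elim (auto simp: indicator_def)
    qed
  qed (use gauss_integrable[OF assms] in \<open>auto split: split_indicator\<close>)
  moreover have "(LINT x|lborel. indicator {u..v} x *\<^sub>R ?g x) = integral {u..v} ?g" for u v
    using set_borel_integral_eq_integral(2)[of "{u..v}" ?g]
      borel_integrable_atLeastAtMost'[of u v ?g]
    by (simp add: set_lebesgue_integral_def continuous_intros)
  ultimately show ?thesis using gauss_integral[OF assms] by simp
qed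

lemma contour_integral_rectpath:
  assumes "Re a1 \<le> Re a3" "Im a1 \<le> Im a3" "continuous_on (path_image (rectpath a1 a3)) f"
  shows "contour_integral (rectpath a1 a3) f =
    contour_integral (linepath a1 (Complex (Re a3) (Im a1))) f +
    contour_integral (linepath (Complex (Re a3) (Im a1)) a3) f +
    contour_integral (linepath a3 (Complex (Re a1) (Im a3))) f +
    contour_integral (linepath (Complex (Re a1) (Im a3)) a1) f"
proof -
  have "f contour_integrable_on linepath a1 (Complex (Re a3) (Im a1))"
    "f contour_integrable_on linepath (Complex (Re a3) (Im a1)) a3"
    "f contour_integrable_on linepath a3 (Complex (Re a1) (Im a3))"
    "f contour_integrable_on linepath (Complex (Re a1) (Im a3)) a1"
    by (auto intro!: contour_integrable_continuous_linepath continuous_on_subset[OF assms(3)]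
             simp: rectpath_def Let_def path_image_join)
  thus ?thesis by (simp add: rectpath_def Let_def)
qed

lemma exp_2pi_i_eq_1_iff: "exp (2 * of_real pi * \<i> * z) = 1 \<longleftrightarrow> z \<in> \<int>"
proof
  assume "exp (2 * of_real pi * \<i> * z) = 1"
  then obtain n :: int where "Im z = 0" "Re z = of_int n"
    unfolding exp_eq_1 by (auto simp: field_simps)
  hence "z = of_int n" by (simp add: complex_eq_iff)
  thus "z \<in> \<int>" by simp
next
  assume "z \<in> \<int>"
  then obtain n :: int where "z = of_int n" by (auto elim: Ints_cases)
  thus "exp (2 * of_real pi * \<i> * z) = 1"
    unfolding exp_eq_1 by (auto intro!: exI[of _ n])
qed

text \<open>
  The factor \<open>1 / (exp (2 \<pi> i z) - 1)\<close> has a simple pole with residue \<open>1 / (2 \<pi> i)\<close> at every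
  integer, so the residue theorem turns a sum over integers into a contour integral. The vertical
  sides run through half-integers, away from the poles. Nonvanishing of \<open>f\<close> at the
  integers makes them genuine poles, to which the residue formula for simple poles applies.
\<close>
lemma sum_integers_eq_contour_integral:
  fixes f :: "complex \<Rightarrow> complex" and M :: nat
  assumes "f holomorphic_on UNIV" "b > 0" "\<And>n::int. f (of_int n) \<noteq> 0"
  shows "contour_integral (rectpath (Complex (- (real M + 1/2)) (-b)) (Complex (real M + 1/2) b))
            (\<lambda>z. f z / (exp (2 * of_real pi * \<i> * z) - 1)) = (\<Sum>n\<in>{- int M..int M}. f (of_int n))"
proof -
  define S :: "complex set" where "S = {z. -(real M + 1) < Re z} \<inter> {z. Re z < real M + 1}"
  define pts :: "complex set" where "pts = of_int ` {- int M..int M}"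
  let ?u = "\<lambda>z. exp (2 * of_real pi * \<i> * z) - 1"
  let ?\<gamma> = "rectpath (Complex (- (real M + 1/2)) (-b)) (Complex (real M + 1/2) b)"
  have zeros: "z \<in> pts" if "z \<in> S" "?u z = 0" for z
  proof -
    from that have "z \<in> \<int>" by (simp add: exp_2pi_i_eq_1_iff)
    then obtain n :: int where n: "z = of_int n" by (auto elim: Ints_cases)
    with that(1) have "- (real M + 1) < of_int n" "of_int n < real M + 1"
      by (auto simp: S_def)
    hence "n \<in> {- int M..int M}" by auto
    thus ?thesis using n by (auto simp: pts_def)
  qed
  have opS: "open S" unfolding S_def by (intro open_Int open_halfspace_Re_gt open_halfspace_Re_lt)
  have conS: "connected S" unfolding S_def
    by (intro convex_connected convex_Int convex_halfspace_Re_gt convex_halfspace_Re_lt)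
  have img: "path_image ?\<gamma> \<subseteq> S - pts"
  proof -
    have "path_image ?\<gamma> \<subseteq> S"
      using assms(2) by (subst path_image_rectpath) (auto simp: S_def)
    moreover have "z \<notin> pts" if "z \<in> path_image ?\<gamma>" for z
    proof
      assume "z \<in> pts"
      then obtain n :: int where n: "z = of_int n" "n \<in> {- int M..int M}" by (auto simp: pts_def)
      from that assms(2) n have "real_of_int n = real M + 1/2 \<or> real_of_int n = - (real M + 1/2)"
        by (subst (asm) path_image_rectpath) auto
      moreover have "real_of_int n \<le> real M" "- real M \<le> real_of_int n" using n by auto
      ultimately show False by auto
    qed
    ultimately show ?thesis by blast
  qed
  have "contour_integral ?\<gamma> (\<lambda>z. f z / ?u z) =
      2 * pi * \<i> * (\<Sum>p\<in>pts. winding_number ?\<gamma> p * residue (\<lambda>z. f z / ?u z) p)"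
  proof (rule Residue_theorem[OF opS conS])
    show "(\<lambda>z. f z / ?u z) holomorphic_on S - pts"
      using zeros by (intro holomorphic_intros holomorphic_on_subset[OF assms(1)]) auto
    show "\<forall>z. z \<notin> S \<longrightarrow> winding_number ?\<gamma> z = 0"
    proof (intro allI impI)
      fix z assume "z \<notin> S"
      thus "winding_number ?\<gamma> z = 0" using assms(2)
        by (intro winding_number_rectpath_outside) (auto simp: S_def in_cbox_complex_iff)
    qed
  qed (use img in \<open>auto simp: pts_def\<close>)
  also have "(\<Sum>p\<in>pts. winding_number ?\<gamma> p * residue (\<lambda>z. f z / ?u z) p) =
      (\<Sum>p\<in>pts. f p / (2 * pi * \<i>))"
  proof (rule sum.cong[OF refl])
    fix p assume p: "p \<in> pts"
    then obtain n :: int where n: "p = of_int n" "n \<in> {- int M..int M}" by (auto simp: pts_def)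
    have "real_of_int n \<le> real M" "- real M \<le> real_of_int n" using n by auto
    hence "winding_number ?\<gamma> p = 1" using assms(2) n
      by (intro winding_number_rectpath) (auto simp: in_box_complex_iff)
    moreover have "residue (\<lambda>z. f z / ?u z) p = f p / (2 * pi * \<i>)"
    proof -
      have e: "exp (2 * of_real pi * \<i> * p) = 1" using n by (subst exp_2pi_i_eq_1_iff) auto
      have du: "(?u has_field_derivative 2 * pi * \<i>) (at p)"
        by (rule derivative_eq_intros refl | simp add: e)+
      show ?thesis using du e assms(1) assms(3)[of n] n
        by (intro residue_simple_pole_deriv[where s = UNIV]) (auto intro!: holomorphic_intros)
    qed
    ultimately show "winding_number ?\<gamma> p * residue (\<lambda>z. f z / ?u z) p = f p / (2 * pi * \<i>)" by simp
  qed
  also have "2 * pi * \<i> * (\<Sum>p\<in>pts. f p / (2 * pi * \<i>)) = (\<Sum>p\<in>pts. f p)"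
    by (simp add: sum_distrib_left)
  also have "\<dots> = (\<Sum>n\<in>{- int M..int M}. f (of_int n))"
    unfolding pts_def by (subst sum.reindex) (auto simp: inj_on_def)
  finally show ?thesis .
qed

lemma norm_gauss_complex:
  "norm (exp (- (of_real a * (Complex x y - of_real t))\<^sup>2)) = exp ((a * y)\<^sup>2) * exp (- (a * (x - t))\<^sup>2)"
  by (simp add: power2_eq_square algebra_simps flip: exp_add)

text \<open>
  On the line \<open>Im z = y\<close> the Gaussian has the modulus of the real Gaussian times
  \<open>exp ((a y)\<^sup>2)\<close>; this is the price for leaving the real axis, to be paid out of the
  smallness \<open>K\<close> of the other factor.
\<close>
lemma gauss_horizontal_integral_bound:
  fixes a t b y R K :: real and k :: "complex \<Rightarrow> complex"
  defines "G \<equiv> \<lambda>z. exp (- (of_real a * (z - of_real t))\<^sup>2)"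
  assumes "a > 0" "R > 0" "\<bar>y\<bar> = b"
    and cont: "continuous_on {z. Im z = y} k"
    and bound: "\<And>x. norm (k (Complex x y)) \<le> K"
  shows "norm (contour_integral (linepath (Complex (-R) y) (Complex R y)) (\<lambda>z. G z * k z))
           \<le> K * exp ((a * b)\<^sup>2) * (sqrt pi / a)"
proof -
  let ?g = "\<lambda>x. exp (- (a * (x - t))\<^sup>2)"
  have K: "K \<ge> 0" using norm_ge_zero bound order_trans by blast
  have "norm (contour_integral (linepath (Complex (-R) y) (Complex R y)) (\<lambda>z. G z * k z))
    = norm (integral {-R..R} (\<lambda>x. G (Complex x y) * k (Complex x y)))"
    using assms by (subst contour_integral_linepath_same_Im) auto
  also have "\<dots> \<le> integral {-R..R} (\<lambda>x. K * exp ((a * b)\<^sup>2) * ?g x)"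
  proof (rule integral_norm_bound_integral)
    have "continuous_on {-R..R} (\<lambda>x. k (Complex x y))"
      by (rule continuous_on_compose2[OF cont]) (auto simp: Complex_eq intro!: continuous_intros)
    thus "(\<lambda>x. G (Complex x y) * k (Complex x y)) integrable_on {-R..R}"
      unfolding G_def Complex_eq by (intro integrable_continuous_real continuous_intros)
    show "(\<lambda>x. K * exp ((a * b)\<^sup>2) * ?g x) integrable_on {-R..R}"
      by (intro integrable_continuous_real continuous_intros)
    fix x
    have "(a * y)\<^sup>2 = (a * b)\<^sup>2" using assms(4) by (metis power2_abs power_mult_distrib)
    hence "norm (G (Complex x y) * k (Complex x y)) = norm (k (Complex x y)) * (exp ((a * b)\<^sup>2) * ?g x)"
      unfolding G_def norm_mult norm_gauss_complex by simp
    also have "\<dots> \<le> K * (exp ((a * b)\<^sup>2) * ?g x)"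
      by (intro mult_right_mono bound) auto
    finally show "norm (G (Complex x y) * k (Complex x y)) \<le> K * exp ((a * b)\<^sup>2) * ?g x" by simp
  qed
  also have "\<dots> = K * exp ((a * b)\<^sup>2) * integral {-R..R} ?g" by simp
  also have "\<dots> \<le> K * exp ((a * b)\<^sup>2) * (sqrt pi / a)"
    using K by (intro mult_left_mono gauss_integral_interval_le assms) auto
  finally show ?thesis .
qed

text \<open>
  The vertical sides contribute nothing in the limit \<open>R \<rightarrow> \<infinity>\<close>, because the Gaussian decays
  on them.
\<close>
lemma gauss_vertical_integral_bound:
  fixes a t b c R :: real and k :: "complex \<Rightarrow> complex"
  defines "G \<equiv> \<lambda>z. exp (- (of_real a * (z - of_real t))\<^sup>2)"
  assumes "a > 0" "\<bar>c\<bar> = R" "R \<ge> \<bar>t\<bar>" "\<bar>u\<bar> \<le> b" "\<bar>v\<bar> \<le> b"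
    and cont: "continuous_on {z. Re z = c} k"
    and bound: "\<And>y. norm (k (Complex c y)) \<le> 1"
  shows "norm (contour_integral (linepath (Complex c u) (Complex c v)) (\<lambda>z. G z * k z))
           \<le> exp ((a * b)\<^sup>2) * exp (- (a * (R - \<bar>t\<bar>))\<^sup>2) * \<bar>v - u\<bar>"
proof -
  have "norm (contour_integral (linepath (Complex c u) (Complex c v)) (\<lambda>z. G z * k z))
           \<le> exp ((a * b)\<^sup>2) * exp (- (a * (R - \<bar>t\<bar>))\<^sup>2) * norm (Complex c v - Complex c u)"
  proof (rule contour_integral_bound_linepath)
    have sub: "closed_segment (Complex c u) (Complex c v) \<subseteq> {z. Re z = c}"
      by (auto simp: closed_segment_same_Re)
    show "(\<lambda>z. G z * k z) contour_integrable_on linepath (Complex c u) (Complex c v)"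
      unfolding G_def
      by (intro contour_integrable_continuous_linepath continuous_intros continuous_on_subset[OF cont sub])
    fix z assume z: "z \<in> closed_segment (Complex c u) (Complex c v)"
    then obtain y where y: "z = Complex c y" "y \<in> closed_segment u v"
      by (auto simp: closed_segment_same_Re complex_eq_iff)
    have "\<bar>y\<bar> \<le> b" using y(2) assms(5,6) by (auto simp: closed_segment_eq_real_ivl split: if_splits)
    hence 1: "(a * y)\<^sup>2 \<le> (a * b)\<^sup>2"
      using assms(2) by (simp add: power_mult_distrib abs_le_square_iff[symmetric])
    have "R - \<bar>t\<bar> \<le> \<bar>c - t\<bar>" using assms(3) by linarith
    hence 2: "(a * (R - \<bar>t\<bar>))\<^sup>2 \<le> (a * (c - t))\<^sup>2"
      using assms(2,4) by (simp add: power_mult_distrib abs_le_square_iff[symmetric])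
    have "norm (G z * k z) = exp ((a * y)\<^sup>2) * exp (- (a * (c - t))\<^sup>2) * norm (k z)"
      unfolding G_def norm_mult y(1) norm_gauss_complex by simp
    also have "\<dots> \<le> exp ((a * b)\<^sup>2) * exp (- (a * (R - \<bar>t\<bar>))\<^sup>2) * 1"
      using 1 2 bound[of y] y by (intro mult_mono) auto
    finally show "norm (G z * k z) \<le> exp ((a * b)\<^sup>2) * exp (- (a * (R - \<bar>t\<bar>))\<^sup>2)" by simp
  qed auto
  also have "norm (Complex c v - Complex c u) = \<bar>v - u\<bar>" by (simp add: cmod_def)
  finally show ?thesis .
qed

text \<open>
  This is the exponentially accurate trapezoidal rule, truncated to finitely many nodes. With
  \<open>u = exp (2 \<pi> i z)\<close>, the sum is the integral of \<open>G / (u - 1)\<close> over the boundary of a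
  rectangle of half-height \<open>b\<close>. On the lower side \<open>u\<close> is large and the integrand is small.
  On the upper side \<open>u\<close> is small, and \<open>1 / (u - 1) = u / (u - 1) - 1\<close> splits the integrand
  into a small part and \<open>-G\<close>, whose integral Cauchy's theorem moves down to the real axis,
  where it becomes the Gaussian integral that the sum approximates. The four pieces of length
  \<open>b\<close> or \<open>2 b\<close> of vertical sides account for the factor \<open>6 b\<close>.
\<close>
lemma truncated_gauss_lattice_sum:
  fixes a b t :: real and M :: nat
  defines "R \<equiv> real M + 1/2"
  assumes "a > 0" "b > 0" "R \<ge> \<bar>t\<bar>"
  shows "\<bar>(\<Sum>n\<in>{- int M..int M}. exp (- (a * (of_int n - t))\<^sup>2)) - integral {-R..R} (\<lambda>x. exp (- (a * (x - t))\<^sup>2))\<bar>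
    \<le> 2 * (1 / (exp (2 * pi * b) - 1) * exp ((a * b)\<^sup>2) * (sqrt pi / a))
       + 6 * b * exp ((a * b)\<^sup>2) * exp (- (a * (R - \<bar>t\<bar>))\<^sup>2)"
proof -
  define G where "G = (\<lambda>z. exp (- (of_real a * (z - of_real t))\<^sup>2) :: complex)"
  define u where "u = (\<lambda>z. exp (2 * of_real pi * \<i> * z))"
  define k where "k = (\<lambda>z. 1 / (u z - 1))"
  define k' where "k' = (\<lambda>z. u z / (u z - 1))"
  define \<kappa> where "\<kappa> = 1 / (exp (2 * pi * b) - 1)"
  define V where "V = exp ((a * b)\<^sup>2) * exp (- (a * (R - \<bar>t\<bar>))\<^sup>2)"
  have R: "R > 0" by (simp add: R_def)
  have eb: "exp (2 * pi * b) > 1" using assms by simp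
  have holG: "G holomorphic_on S" for S unfolding G_def by (intro holomorphic_intros)
  have contG: "continuous_on S G" for S unfolding G_def by (intro continuous_intros)
  have normu: "norm (u z) = exp (- (2 * pi * Im z))" for z by (simp add: u_def)
  have contu: "continuous_on S u" for S unfolding u_def by (intro continuous_intros)
  have u_re: "Re (u (Complex c y)) = - exp (- (2 * pi * y))" if "\<bar>c\<bar> = R" for c y
  proof -
    have "cos (2 * pi * R) = -1"
      using cos_2npi[of M] by (simp add: R_def distrib_left cos_add mult_ac)
    hence "cos (2 * pi * c) = -1" using that by (cases "c \<ge> 0") (auto simp: abs_if)
    thus ?thesis by (simp add: u_def Re_exp)
  qed
  have side_lb: "norm (u (Complex c y) - 1) \<ge> 1" if "\<bar>c\<bar> = R" for c y
  proof -
    have "\<bar>- exp (- (2 * pi * y)) - 1\<bar> \<le> norm (u (Complex c y) - 1)"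
      using abs_Re_le_cmod[of "u (Complex c y) - 1"] u_re[OF that, of y] by simp
    thus ?thesis using exp_ge_zero[of "- (2 * pi * y)"] by linarith
  qed
  have u_ne: "u z - 1 \<noteq> 0" if "Im z \<noteq> 0 \<or> \<bar>Re z\<bar> = R" for z
    using that
  proof
    assume "Im z \<noteq> 0"
    hence "norm (u z) \<noteq> 1" by (simp add: normu)
    thus ?thesis by auto
  next
    assume "\<bar>Re z\<bar> = R"
    thus ?thesis using side_lb[of "Re z" "Im z"] by auto
  qed
  have contk: "continuous_on {z. Im z \<noteq> 0 \<or> \<bar>Re z\<bar> = R} k"
    "continuous_on {z. Im z \<noteq> 0 \<or> \<bar>Re z\<bar> = R} k'"
    unfolding k_def k'_def using u_ne by (auto intro!: continuous_intros contu)
  have k_bottom: "norm (k (Complex x (-b))) \<le> \<kappa>" for x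
  proof -
    have "exp (2 * pi * b) - 1 \<le> norm (u (Complex x (-b)) - 1)"
      using norm_triangle_ineq2[of "u (Complex x (-b))" 1] by (simp add: normu)
    thus ?thesis using eb unfolding k_def \<kappa>_def norm_divide norm_one by (intro divide_left_mono mult_pos_pos) auto
  qed
  have k'_top: "norm (k' (Complex x b)) \<le> \<kappa>" for x
  proof -
    let ?z = "Complex x b"
    have nz: "norm (u ?z) = exp (- (2 * pi * b))" by (simp add: normu)
    have lb: "1 - exp (- (2 * pi * b)) \<le> norm (u ?z - 1)"
      using norm_triangle_ineq2[of 1 "u ?z"] by (simp add: nz norm_minus_commute)
    have "norm (k' ?z) \<le> exp (- (2 * pi * b)) / (1 - exp (- (2 * pi * b)))"
    proof -
      have "exp (- (2 * pi * b)) < 1" using assms by simp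
      thus ?thesis unfolding k'_def norm_divide nz
        using lb by (intro divide_left_mono mult_pos_pos; (linarith | simp))
    qed
    also have "\<dots> = \<kappa>" using eb by (simp add: \<kappa>_def exp_minus divide_simps)
    finally show ?thesis .
  qed
  have k_side: "norm (k (Complex c y)) \<le> 1" if "\<bar>c\<bar> = R" for c y
    using side_lb[OF that, of y] by (simp add: k_def norm_divide divide_simps)

  \<comment> \<open>On the upper side \<open>k = k' - 1\<close> trades the large kernel for a small one and a copy of \<open>G\<close>.\<close>
  let ?BL = "Complex (-R) (-b)" and ?BR = "Complex R (-b)" and ?TR = "Complex R b" and ?TL = "Complex (-R) b"
  let ?L = "Complex (-R) 0" and ?Q = "Complex R 0"
  let ?I = "\<lambda>p q f. contour_integral (linepath p q) f"
  have "of_real (\<Sum>n\<in>{- int M..int M}. exp (- (a * (of_int n - t))\<^sup>2)) = (\<Sum>n\<in>{- int M..int M}. G (of_int n))"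
    by (simp add: G_def flip: exp_of_real)
  also have "\<dots> = contour_integral (rectpath ?BL ?TR) (\<lambda>z. G z * k z)"
    using sum_integers_eq_contour_integral[OF holG \<open>b > 0\<close>, of M]
    by (simp add: G_def k_def u_def R_def)
  also have "\<dots> = ?I ?BL ?BR (\<lambda>z. G z * k z) + ?I ?BR ?TR (\<lambda>z. G z * k z)
       + ?I ?TR ?TL (\<lambda>z. G z * k z) + ?I ?TL ?BL (\<lambda>z. G z * k z)"
    using assms R
    by (subst contour_integral_rectpath)
       (auto simp: path_image_rectpath intro!: continuous_intros contG continuous_on_subset[OF contk(1)])
  also have "?I ?TR ?TL (\<lambda>z. G z * k z) = ?I ?TR ?TL (\<lambda>z. G z * k' z - G z)"
    using assms R u_ne
    by (intro contour_integral_eq) (auto simp: closed_segment_same_Im k_def k'_def divide_simps algebra_simps)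
  also have "\<dots> = ?I ?TR ?TL (\<lambda>z. G z * k' z) - ?I ?TR ?TL G"
    using assms R
    by (intro contour_integral_diff contour_integrable_continuous_linepath continuous_intros contG
         continuous_on_subset[OF contk(2)]) (auto simp: closed_segment_same_Im)
  also have "?I ?TR ?TL (\<lambda>z. G z * k' z) = - ?I ?TL ?TR (\<lambda>z. G z * k' z)"
    using assms R
    by (intro contour_integral_reverse_linepath continuous_intros contG
         continuous_on_subset[OF contk(2)]) (auto simp: closed_segment_same_Im)
  finally have res: "of_real (\<Sum>n\<in>{- int M..int M}. exp (- (a * (of_int n - t))\<^sup>2)) =
     ?I ?BL ?BR (\<lambda>z. G z * k z) + ?I ?BR ?TR (\<lambda>z. G z * k z)
     + (- ?I ?TL ?TR (\<lambda>z. G z * k' z) - ?I ?TR ?TL G) + ?I ?TL ?BL (\<lambda>z. G z * k z)" .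

  \<comment> \<open>Cauchy's theorem on the upper half of the rectangle moves that copy to the real axis.\<close>
  have "(G has_contour_integral 0) (rectpath ?L ?TR)"
    by (rule Cauchy_theorem_convex_simple[OF holG[of UNIV]]) auto
  hence "contour_integral (rectpath ?L ?TR) G = 0" by (rule contour_integral_unique)
  hence "?I ?L ?Q G + ?I ?Q ?TR G + ?I ?TR ?TL G + ?I ?TL ?L G = 0"
    using assms R by (subst (asm) contour_integral_rectpath) (auto intro: contG)
  moreover have "?I ?L ?Q G = of_real (integral {-R..R} (\<lambda>x. exp (- (a * (x - t))\<^sup>2)))"
  proof -
    have "?I ?L ?Q G = integral {-R..R} (\<lambda>x. of_real (exp (- (a * (x - t))\<^sup>2)))"
      using R by (subst contour_integral_linepath_same_Im)
        (auto simp: G_def Complex_eq simp flip: exp_of_real)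
    also have "\<dots> = of_real (integral {-R..R} (\<lambda>x. exp (- (a * (x - t))\<^sup>2)))"
      by (intro integral_unique has_integral_of_real integrable_integral integrable_continuous_real continuous_intros)
    finally show ?thesis .
  qed
  ultimately have top: "?I ?TR ?TL G = - (of_real (integral {-R..R} (\<lambda>x. exp (- (a * (x - t))\<^sup>2)))
      + ?I ?Q ?TR G + ?I ?TL ?L G)"
    by (subst eq_neg_iff_add_eq_0) (simp add: add_ac)
  have "of_real ((\<Sum>n\<in>{- int M..int M}. exp (- (a * (of_int n - t))\<^sup>2))
       - integral {-R..R} (\<lambda>x. exp (- (a * (x - t))\<^sup>2))) =
     ?I ?BL ?BR (\<lambda>z. G z * k z) - ?I ?TL ?TR (\<lambda>z. G z * k' z)
     + ?I ?BR ?TR (\<lambda>z. G z * k z) + ?I ?TL ?BL (\<lambda>z. G z * k z)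
     + ?I ?Q ?TR (\<lambda>z. G z * 1) + ?I ?TL ?L (\<lambda>z. G z * 1)" (is "of_real ?D = ?i1 - ?i2 + ?i3 + ?i4 + ?i5 + ?i6")
    unfolding of_real_diff res top by simp
  from arg_cong[OF this, of norm] have "\<bar>?D\<bar> = norm (?i1 - ?i2 + ?i3 + ?i4 + ?i5 + ?i6)"
    unfolding norm_of_real .
  also have "\<dots> \<le> norm ?i1 + norm ?i2 + norm ?i3 + norm ?i4 + norm ?i5 + norm ?i6"
    by (intro norm_triangle_mono norm_triangle_ineq4 order_refl)
  also have "norm ?i1 \<le> \<kappa> * exp ((a * b)\<^sup>2) * (sqrt pi / a)"
    unfolding G_def using assms R k_bottom
    by (intro gauss_horizontal_integral_bound continuous_on_subset[OF contk(1)]) auto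
  also have "norm ?i2 \<le> \<kappa> * exp ((a * b)\<^sup>2) * (sqrt pi / a)"
    unfolding G_def using assms R k'_top
    by (intro gauss_horizontal_integral_bound continuous_on_subset[OF contk(2)]) auto
  also have "norm ?i3 \<le> V * \<bar>b - (-b)\<bar>"
    unfolding G_def V_def using assms R k_side
    by (intro gauss_vertical_integral_bound continuous_on_subset[OF contk(1)]) auto
  also have "norm ?i4 \<le> V * \<bar>- b - b\<bar>"
    unfolding G_def V_def using assms R k_side
    by (intro gauss_vertical_integral_bound continuous_on_subset[OF contk(1)]) auto
  also have "norm ?i5 \<le> V * \<bar>b - 0\<bar>"
    unfolding G_def V_def using assms R
    by (intro gauss_vertical_integral_bound) auto
  also have "norm ?i6 \<le> V * \<bar>0 - b\<bar>"
    unfolding G_def V_def using assms R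
    by (intro gauss_vertical_integral_bound) auto
  finally show ?thesis using \<open>b > 0\<close> by (simp add: \<kappa>_def V_def algebra_simps)
qed

lemma filterlim_symmetric_int_intervals:
  "filterlim (\<lambda>M. {- int M..int M}) (finite_subsets_at_top UNIV) sequentially"
  unfolding filterlim_finite_subsets_at_top
proof (intro allI impI)
  fix X :: "int set" assume "finite X \<and> X \<subseteq> UNIV"
  hence X: "finite (abs ` X)" by simp
  have "\<forall>\<^sub>F M in sequentially. int M \<ge> Max (insert 0 (abs ` X))"
    by (rule eventually_sequentiallyI[of "nat (Max (insert 0 (abs ` X)))"]) linarith
  thus "\<forall>\<^sub>F M in sequentially. finite {- int M..int M} \<and> X \<subseteq> {- int M..int M} \<and> {- int M..int M} \<subseteq> UNIV"
  proof eventually_elim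
    case (elim M)
    have "x \<in> {- int M..int M}" if "x \<in> X" for x
    proof -
      have "\<bar>x\<bar> \<le> Max (insert 0 (abs ` X))" using that X by (intro Max_ge) auto
      thus ?thesis using elim by auto
    qed
    thus ?case by auto
  qed
qed

text \<open>
  The second part is the bound that Poisson summation gives for the theta function,
  \<open>1 + 2 q cos (2 \<pi> t) + 2 q\<^sup>4 cos (4 \<pi> t) + \<dots>\<close>. It comes from letting the truncation
  tend to infinity with half-height \<open>b = \<pi> / a\<^sup>2\<close>, which minimizes
  \<open>exp ((a b)\<^sup>2 - 2 \<pi> b)\<close> and makes it equal to \<open>q\<close>.
\<close>
lemma
  fixes a t :: real
  assumes "a > 0"
  defines "q \<equiv> exp (- (pi / a)\<^sup>2)"
  shows summable_on_gauss_lattice: "(\<lambda>n::int. exp (- (a * (of_int n - t))\<^sup>2)) summable_on UNIV"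
    and gauss_lattice_sum_approx:
      "\<bar>(a / sqrt pi) * (\<Sum>\<^sub>\<infinity>n::int. exp (- (a * (of_int n - t))\<^sup>2)) - 1\<bar> \<le> 2 * q / (1 - q\<^sup>2)"
proof -
  define w where "w = (\<lambda>n::int. exp (- (a * (of_int n - t))\<^sup>2))"
  define I where "I = (\<lambda>M. integral {- (real M + 1/2)..real M + 1/2} (\<lambda>x. exp (- (a * (x - t))\<^sup>2)))"
  define S where "S = (\<lambda>M. \<Sum>n\<in>{- int M..int M}. w n)"
  define b where "b = pi / a\<^sup>2"
  define c where "c = (sqrt pi / a) * (q / (1 - q\<^sup>2))"
  define V where "V = (\<lambda>M. 6 * b * exp ((a * b)\<^sup>2) * exp (- (a * (real M + 1/2 - \<bar>t\<bar>))\<^sup>2))"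
  have b: "b > 0" using assms by (simp add: b_def)
  have q: "0 < q" "q < 1" using assms by (auto simp: q_def)
  have c_eq: "1 / (exp (2 * pi * b) - 1) * exp ((a * b)\<^sup>2) * (sqrt pi / a) = c"
  proof -
    have ab: "(a * b)\<^sup>2 = (pi / a)\<^sup>2" using assms by (simp add: b_def power2_eq_square)
    have "2 * pi * b = (pi / a)\<^sup>2 + (pi / a)\<^sup>2" using assms by (simp add: b_def power2_eq_square)
    hence e: "exp (2 * pi * b) = exp ((pi / a)\<^sup>2) * exp ((pi / a)\<^sup>2)" by (simp only: exp_add)
    have qq: "exp ((pi / a)\<^sup>2) = 1 / q" by (simp add: q_def exp_minus field_simps)
    show ?thesis unfolding c_def e ab qq using q
      by (simp add: divide_simps power2_eq_square)
  qed
  have bound: "\<bar>S M - I M\<bar> \<le> 2 * c + V M" if "real M \<ge> \<bar>t\<bar>" for M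
    using truncated_gauss_lattice_sum[of a b t M] that assms b
    unfolding c_eq S_def I_def V_def w_def by simp
  have summ: "w summable_on UNIV"
  proof (rule nonneg_bdd_above_summable_on)
    show "bdd_above (sum w ` {F. F \<subseteq> UNIV \<and> finite F})"
    proof (rule bdd_aboveI2)
      fix F :: "int set" assume "F \<in> {F. F \<subseteq> UNIV \<and> finite F}"
      hence "\<forall>\<^sub>F M in sequentially. F \<subseteq> {- int M..int M}"
        using filterlim_symmetric_int_intervals unfolding filterlim_finite_subsets_at_top
        by (auto elim: eventually_mono)
      moreover have "\<forall>\<^sub>F M in sequentially. real M \<ge> \<bar>t\<bar>"
        using filterlim_real_sequentially by (simp add: filterlim_at_top)
      ultimately have "\<forall>\<^sub>F M in sequentially. F \<subseteq> {- int M..int M} \<and> real M \<ge> \<bar>t\<bar>"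
        by (rule eventually_conj)
      then obtain M where M: "F \<subseteq> {- int M..int M}" "real M \<ge> \<bar>t\<bar>"
        using eventually_happens'[OF sequentially_bot] by blast
      have "sum w F \<le> S M" unfolding S_def using M by (intro sum_mono2) (auto simp: w_def)
      also have "\<dots> \<le> I M + 2 * c + V M" using bound[OF M(2)] by linarith
      also have "I M \<le> sqrt pi / a" unfolding I_def by (intro gauss_integral_interval_le assms)
      also have "V M \<le> 6 * b * exp ((a * b)\<^sup>2)" unfolding V_def using b by simp
      finally show "sum w F \<le> sqrt pi / a + 2 * c + 6 * b * exp ((a * b)\<^sup>2)" by simp
    qed
  qed (simp add: w_def)
  thus "(\<lambda>n::int. exp (- (a * (of_int n - t))\<^sup>2)) summable_on UNIV" by (simp add: w_def)
  have "S \<longlonglongrightarrow> infsum w UNIV"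
    unfolding S_def using filterlim_compose[OF infsum_tendsto[OF summ] filterlim_symmetric_int_intervals] .
  moreover have "I \<longlonglongrightarrow> sqrt pi / a"
    unfolding I_def using gauss_integral_interval_tendsto[OF assms(1)] .
  moreover have "V \<longlonglongrightarrow> 0"
    unfolding V_def using assms by real_asymp
  moreover have "\<forall>\<^sub>F M in sequentially. \<bar>S M - I M\<bar> \<le> 2 * c + V M"
    using filterlim_real_sequentially unfolding filterlim_at_top
    by (auto intro: bound elim!: allE[of _ "\<bar>t\<bar>"] eventually_mono)
  ultimately have "\<bar>infsum w UNIV - sqrt pi / a\<bar> \<le> 2 * c + 0"
    by (intro tendsto_le[OF sequentially_bot, of "\<lambda>M. 2 * c + V M" _ "\<lambda>M. \<bar>S M - I M\<bar>"] tendsto_intros)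
  hence "(a / sqrt pi) * \<bar>infsum w UNIV - sqrt pi / a\<bar> \<le> (a / sqrt pi) * (2 * c)"
    using assms by (intro mult_left_mono) auto
  also have "(a / sqrt pi) * \<bar>infsum w UNIV - sqrt pi / a\<bar> = \<bar>(a / sqrt pi) * infsum w UNIV - 1\<bar>"
  proof -
    have "(a / sqrt pi) * infsum w UNIV - 1 = (a / sqrt pi) * (infsum w UNIV - sqrt pi / a)"
      using assms by (simp add: right_diff_distrib)
    thus ?thesis using assms by (simp add: abs_mult)
  qed
  also have "(a / sqrt pi) * (2 * c) = 2 * q / (1 - q\<^sup>2)"
    using assms by (simp add: c_def)
  finally show "\<bar>(a / sqrt pi) * (\<Sum>\<^sub>\<infinity>n::int. exp (- (a * (of_int n - t))\<^sup>2)) - 1\<bar> \<le> 2 * q / (1 - q\<^sup>2)"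
    by (simp add: w_def)
qed

section \<open>Square integrable functions and density of continuous ones\<close>

lemma L2_norm_nonneg [simp]: "L2_norm S u \<ge> 0"
  by (simp add: L2_norm_def)

lemma L2_norm_power2: "(L2_norm S u)\<^sup>2 = (LINT x|lebesgue_on S. (cmod (u x))\<^sup>2)"
  by (simp add: L2_norm_def)

lemma square_integrable_add:
  assumes "square_integrable S u" "square_integrable S v"
  shows "square_integrable S (\<lambda>x. u x + v x)"
proof -
  have [measurable]: "u \<in> borel_measurable (lebesgue_on S)" "v \<in> borel_measurable (lebesgue_on S)"
    using assms by (auto simp: square_integrable_def)
  have "integrable (lebesgue_on S) (\<lambda>x. (cmod (u x + v x))\<^sup>2)"
  proof (rule Bochner_Integration.integrable_bound)
    show "integrable (lebesgue_on S) (\<lambda>x. 2 * (cmod (u x))\<^sup>2 + 2 * (cmod (v x))\<^sup>2)"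
      using assms by (auto simp: square_integrable_def)
    have "(cmod (u x + v x))\<^sup>2 \<le> 2 * (cmod (u x))\<^sup>2 + 2 * (cmod (v x))\<^sup>2" for x
    proof -
      have "(cmod (u x + v x))\<^sup>2 \<le> (cmod (u x) + cmod (v x))\<^sup>2"
        by (intro power_mono norm_triangle_ineq) auto
      also have "\<dots> \<le> 2 * (cmod (u x))\<^sup>2 + 2 * (cmod (v x))\<^sup>2"
        using sum_squares_bound[of "cmod (u x)" "cmod (v x)"] by (simp add: power2_sum)
      finally show ?thesis .
    qed
    thus "AE x in lebesgue_on S. norm ((cmod (u x + v x))\<^sup>2) \<le> norm (2 * (cmod (u x))\<^sup>2 + 2 * (cmod (v x))\<^sup>2)"
      by (intro AE_I2) auto
  qed measurable
  thus ?thesis by (simp add: square_integrable_def)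
qed

lemma square_integrable_uminus: "square_integrable S u \<Longrightarrow> square_integrable S (\<lambda>x. - u x)"
  by (simp add: square_integrable_def borel_measurable_uminus)

lemma square_integrable_diff:
  "square_integrable S u \<Longrightarrow> square_integrable S v \<Longrightarrow> square_integrable S (\<lambda>x. u x - v x)"
  using square_integrable_add[OF _ square_integrable_uminus, of S u v] by simp

text \<open>
  Weighting the inequality between the arithmetic and the geometric mean by the two norms gives
  a pointwise bound whose integral is exactly the square of the sum of the norms. The norms are
  enlarged by \<open>e / 2\<close> first so that the weights are defined even if a norm is zero.
\<close>
lemma L2_norm_triangle:
  assumes "square_integrable S u" "square_integrable S v"
  shows "L2_norm S (\<lambda>x. u x + v x) \<le> L2_norm S u + L2_norm S v"
proof (rule field_le_epsilon)
  fix e :: real assume "e > 0"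
  define s t where "s = L2_norm S u + e / 2" and "t = L2_norm S v + e / 2"
  have st: "s > 0" "t > 0" "L2_norm S u \<le> s" "L2_norm S v \<le> t"
    using \<open>e > 0\<close> by (auto simp: s_def t_def add_nonneg_pos)
  have int: "integrable (lebesgue_on S) (\<lambda>x. (cmod (u x))\<^sup>2)" "integrable (lebesgue_on S) (\<lambda>x. (cmod (v x))\<^sup>2)"
    "integrable (lebesgue_on S) (\<lambda>x. (cmod (u x + v x))\<^sup>2)"
    using assms square_integrable_add[OF assms] by (auto simp: square_integrable_def)
  have pw: "(cmod (u x + v x))\<^sup>2 \<le> (1 + t / s) * (cmod (u x))\<^sup>2 + (1 + s / t) * (cmod (v x))\<^sup>2" for x
  proof -
    have "(cmod (u x + v x))\<^sup>2 \<le> (cmod (u x) + cmod (v x))\<^sup>2"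
      by (intro power_mono norm_triangle_ineq) auto
    have "(t * cmod (u x) - s * cmod (v x))\<^sup>2 / (s * t)
        = t / s * (cmod (u x))\<^sup>2 + s / t * (cmod (v x))\<^sup>2 - 2 * cmod (u x) * cmod (v x)"
      using st by (simp add: power2_diff power_mult_distrib diff_divide_distrib add_divide_distrib)
        (simp add: power2_eq_square)
    moreover have "0 \<le> (t * cmod (u x) - s * cmod (v x))\<^sup>2 / (s * t)" using st by simp
    ultimately have "2 * cmod (u x) * cmod (v x) \<le> t / s * (cmod (u x))\<^sup>2 + s / t * (cmod (v x))\<^sup>2"
      by linarith
    moreover have "(cmod (u x) + cmod (v x))\<^sup>2
        = (cmod (u x))\<^sup>2 + (cmod (v x))\<^sup>2 + 2 * cmod (u x) * cmod (v x)" by (simp add: power2_sum)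
    moreover note \<open>(cmod (u x + v x))\<^sup>2 \<le> (cmod (u x) + cmod (v x))\<^sup>2\<close>
    ultimately show ?thesis by (simp add: distrib_right)
  qed
  have "(L2_norm S (\<lambda>x. u x + v x))\<^sup>2
      \<le> (LINT x|lebesgue_on S. (1 + t / s) * (cmod (u x))\<^sup>2 + (1 + s / t) * (cmod (v x))\<^sup>2)"
    unfolding L2_norm_power2 using int pw by (intro integral_mono) auto
  also have "\<dots> = (1 + t / s) * (L2_norm S u)\<^sup>2 + (1 + s / t) * (L2_norm S v)\<^sup>2"
    unfolding L2_norm_power2 using int by (subst Bochner_Integration.integral_add) auto
  also have "\<dots> \<le> (1 + t / s) * s\<^sup>2 + (1 + s / t) * t\<^sup>2"
    using st by (intro add_mono mult_left_mono power_mono) auto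
  also have "\<dots> = s\<^sup>2 + t\<^sup>2 + (t / s * s\<^sup>2 + s / t * t\<^sup>2)" by (simp add: algebra_simps)
  also have "t / s * s\<^sup>2 + s / t * t\<^sup>2 = 2 * s * t" using st by (simp add: power2_eq_square)
  also have "s\<^sup>2 + t\<^sup>2 + 2 * s * t = (s + t)\<^sup>2" by (simp add: power2_sum)
  finally have "(L2_norm S (\<lambda>x. u x + v x))\<^sup>2 \<le> (s + t)\<^sup>2" .
  hence "L2_norm S (\<lambda>x. u x + v x) \<le> s + t" by (rule power2_le_imp_le) (use st in linarith)
  thus "L2_norm S (\<lambda>x. u x + v x) \<le> L2_norm S u + L2_norm S v + e" by (simp add: s_def t_def)
qed

lemma L2_norm_uminus [simp]: "L2_norm S (\<lambda>x. - u x) = L2_norm S u"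
  by (simp add: L2_norm_def)

lemma L2_norm_cmult: "L2_norm S (\<lambda>x. c * u x) = cmod c * L2_norm S u"
  by (simp add: L2_norm_def norm_mult power_mult_distrib real_sqrt_mult)

lemma
  fixes u :: "real \<Rightarrow> complex"
  assumes u: "u \<in> borel_measurable (lebesgue_on S)" and v: "square_integrable S v"
    and le: "\<And>x. x \<in> S \<Longrightarrow> cmod (u x) \<le> cmod (v x)"
  shows square_integrable_mono: "square_integrable S u"
    and L2_norm_mono: "L2_norm S u \<le> L2_norm S v"
proof -
  have int: "integrable (lebesgue_on S) (\<lambda>x. (cmod (u x))\<^sup>2)"
  proof (rule Bochner_Integration.integrable_bound)
    show "integrable (lebesgue_on S) (\<lambda>x. (cmod (v x))\<^sup>2)" using v by (simp add: square_integrable_def)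
    show "AE x in lebesgue_on S. norm ((cmod (u x))\<^sup>2) \<le> norm ((cmod (v x))\<^sup>2)"
      using le by (intro AE_I2) (auto intro!: power_mono simp: space_restrict_space)
  qed (use u in measurable)
  thus "square_integrable S u" using u by (simp add: square_integrable_def)
  show "L2_norm S u \<le> L2_norm S v"
    unfolding L2_norm_def using int v le
    by (intro real_sqrt_le_mono integral_mono) (auto simp: square_integrable_def space_restrict_space intro!: power_mono)
qed

lemma
  assumes "S \<in> sets lebesgue"
  shows square_integrable_extend:
      "square_integrable UNIV (\<lambda>x. indicat_real S x *\<^sub>R u x) \<longleftrightarrow> square_integrable S u"
    and L2_norm_extend: "L2_norm UNIV (\<lambda>x. indicat_real S x *\<^sub>R u x) = L2_norm S u"
proof -
  have sq: "(cmod (indicat_real S x *\<^sub>R u x))\<^sup>2 = indicat_real S x *\<^sub>R (cmod (u x))\<^sup>2" for x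
    by (auto simp: indicator_def)
  show "square_integrable UNIV (\<lambda>x. indicat_real S x *\<^sub>R u x) \<longleftrightarrow> square_integrable S u"
    unfolding square_integrable_def lebesgue_on_UNIV_eq sq using assms
    by (simp add: borel_measurable_restrict_space_iff integrable_restrict_space mult.commute)
  show "L2_norm UNIV (\<lambda>x. indicat_real S x *\<^sub>R u x) = L2_norm S u"
    unfolding L2_norm_def lebesgue_on_UNIV_eq sq using assms
    by (simp add: integral_restrict_space)
qed

lemma L2_norm_bounded:
  assumes "S \<in> lmeasurable" "\<And>x. x \<in> S \<Longrightarrow> cmod (u x) \<le> m" "u \<in> borel_measurable (lebesgue_on S)"
  shows "square_integrable S u" "L2_norm S u \<le> m * sqrt (measure lebesgue S)"
proof -
  interpret finite_measure "lebesgue_on S"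
    using assms(1) by (intro finite_measure_lebesgue_on)
  have c: "square_integrable S (\<lambda>_. complex_of_real m)" by (simp add: square_integrable_def)
  have le: "cmod (u x) \<le> cmod (complex_of_real m)" if "x \<in> S" for x
    using assms(2)[OF that] norm_ge_zero[of "u x"] by simp
  show "square_integrable S u" by (rule square_integrable_mono[OF assms(3) c le])
  show "L2_norm S u \<le> m * sqrt (measure lebesgue S)"
  proof (cases "S = {}")
    case False
    hence "m \<ge> 0" using assms(2) norm_ge_zero order_trans by blast
    have "L2_norm S u \<le> L2_norm S (\<lambda>_. complex_of_real m)" by (rule L2_norm_mono[OF assms(3) c le])
    also have "\<dots> = m * sqrt (measure lebesgue S)" using \<open>m \<ge> 0\<close> assms(1)
      by (simp add: L2_norm_def real_sqrt_mult measure_restrict_space space_restrict_space)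
    finally show ?thesis .
  qed (simp add: L2_norm_def)
qed

lemma L2_norm_tendsto_0:
  assumes "\<And>n. u n \<in> borel_measurable (lebesgue_on S)" "square_integrable S w"
    and "AE x in lebesgue_on S. (\<lambda>n. u n x) \<longlonglongrightarrow> 0"
    and "\<And>n x. cmod (u n x) \<le> cmod (w x)"
  shows "(\<lambda>n::nat. L2_norm S (u n)) \<longlonglongrightarrow> 0"
proof -
  have "(\<lambda>n. LINT x|lebesgue_on S. (cmod (u n x))\<^sup>2) \<longlonglongrightarrow> (LINT x|lebesgue_on S. 0)"
  proof (rule integral_dominated_convergence[where w = "\<lambda>x. (cmod (w x))\<^sup>2"])
    show "integrable (lebesgue_on S) (\<lambda>x. (cmod (w x))\<^sup>2)" using assms(2) by (simp add: square_integrable_def)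
    show "AE x in lebesgue_on S. (\<lambda>n. (cmod (u n x))\<^sup>2) \<longlonglongrightarrow> 0"
      using assms(3)
    proof eventually_elim
      case (elim x)
      from tendsto_power[OF tendsto_norm[OF elim], of 2] show ?case by simp
    qed
    show "AE x in lebesgue_on S. norm ((cmod (u n x))\<^sup>2) \<le> (cmod (w x))\<^sup>2" for n
      using assms(4) by (intro AE_I2) (auto intro!: power_mono)
    show "(\<lambda>x. (cmod (u n x))\<^sup>2) \<in> borel_measurable (lebesgue_on S)" for n
      using assms(1)[of n] by measurable
  qed auto
  from tendsto_real_sqrt[OF this] show ?thesis by (simp add: L2_norm_def)
qed

text \<open>
  The radial projection onto the disc of radius \<open>m\<close>.
\<close>
definition truncate :: "real \<Rightarrow> complex \<Rightarrow> complex" where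
  "truncate m w = (m / max m (cmod w)) *\<^sub>R w"

lemma
  assumes "m > 0"
  shows continuous_on_truncate: "continuous_on A (truncate m)"
    and norm_truncate_le: "cmod (truncate m w) \<le> m"
    and norm_diff_truncate_le: "cmod (w - truncate m w) \<le> cmod w"
    and truncate_id: "cmod w \<le> m \<Longrightarrow> truncate m w = w"
proof -
  show "continuous_on A (truncate m)"
    unfolding truncate_def using assms by (intro continuous_intros) (auto simp: max_def)
  show "cmod (truncate m w) \<le> m" using assms by (auto simp: truncate_def max_def)
  have "w - truncate m w = (1 - m / max m (cmod w)) *\<^sub>R w" by (simp add: truncate_def algebra_simps)
  hence "cmod (w - truncate m w) = \<bar>1 - m / max m (cmod w)\<bar> * cmod w" by simp
  also have "\<dots> \<le> 1 * cmod w" using assms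
    by (intro mult_right_mono) (auto simp: max_def abs_if divide_simps)
  finally show "cmod (w - truncate m w) \<le> cmod w" by simp
  show "cmod w \<le> m \<Longrightarrow> truncate m w = w" using assms by (simp add: truncate_def max_def)
qed

text \<open>
  Measurability already provides continuous functions converging almost everywhere. Truncating
  their values and multiplying with a cutoff that is \<open>1\<close> on \<open>[-B, B]\<close> and vanishes outside
  \<open>(-T, T)\<close> provides a common square integrable bound, so that almost everywhere convergence
  becomes convergence in the norm. The approximant is measured on the whole line, because the size
  of the coefficients depends on its values at all nodes and not only on those in \<open>S\<close>.
\<close>
lemma continuous_approx_L2:
  assumes "S \<in> sets lebesgue" "S \<subseteq> {-B..B}" "B < T" "square_integrable S f" "e > 0"
  obtains g where "continuous_on UNIV g" "\<And>x. \<bar>x\<bar> \<ge> T \<Longrightarrow> g x = 0" "square_integrable UNIV g"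
    "L2_norm UNIV (\<lambda>x. indicat_real S x *\<^sub>R f x - g x) < e"
proof -
  define f0 where "f0 = (\<lambda>x. indicat_real S x *\<^sub>R f x)"
  have sq0: "square_integrable UNIV f0"
    unfolding f0_def using assms by (simp add: square_integrable_extend)
  hence m0: "f0 \<in> borel_measurable lebesgue" by (simp add: square_integrable_def lebesgue_on_UNIV_eq)
  then have "f0 measurable_on UNIV" by (simp add: lebesgue_measurable_imp_measurable_on)
  then obtain N g where N: "negligible N" and g: "\<And>n. continuous_on UNIV (g n)"
    and lim: "\<And>x. x \<notin> N \<Longrightarrow> (\<lambda>n. g n x) \<longlonglongrightarrow> f0 x"
    unfolding measurable_on_def by auto
  have meas_trunc: "(\<lambda>x. truncate (real (Suc m)) (f0 x)) \<in> borel_measurable lebesgue" for m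
    by (rule measurable_compose[OF m0 borel_measurable_continuous_onI]) (auto intro: continuous_on_truncate)
  \<comment> \<open>Truncation at a high level changes \<open>f0\<close> only little in the norm.\<close>
  have "(\<lambda>m. L2_norm UNIV (\<lambda>x. f0 x - truncate (real (Suc m)) (f0 x))) \<longlonglongrightarrow> 0"
  proof (rule L2_norm_tendsto_0[OF _ sq0])
    show "(\<lambda>x. f0 x - truncate (real (Suc m)) (f0 x)) \<in> borel_measurable (lebesgue_on UNIV)" for m
      using m0 meas_trunc[of m] by (simp add: lebesgue_on_UNIV_eq)
    show "AE x in lebesgue_on UNIV. (\<lambda>m. f0 x - truncate (real (Suc m)) (f0 x)) \<longlonglongrightarrow> 0"
    proof (intro AE_I2 tendsto_eventually)
      fix x
      have "\<forall>\<^sub>F m in sequentially. real m \<ge> cmod (f0 x)"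
        using filterlim_real_sequentially by (simp add: filterlim_at_top)
      thus "\<forall>\<^sub>F m in sequentially. f0 x - truncate (real (Suc m)) (f0 x) = 0"
        by eventually_elim (simp add: truncate_id)
    qed
  qed (auto intro: norm_diff_truncate_le)
  hence "\<forall>\<^sub>F m in sequentially. L2_norm UNIV (\<lambda>x. f0 x - truncate (real (Suc m)) (f0 x)) < e / 2"
    using assms by (intro order_tendstoD) auto
  then obtain m where m: "L2_norm UNIV (\<lambda>x. f0 x - truncate (real (Suc m)) (f0 x)) < e / 2"
    using eventually_happens'[OF sequentially_bot] by blast
  define M where "M = real (Suc m)"
  have M: "M > 0" by (simp add: M_def)
  define cut where "cut = (\<lambda>x::real. min 1 (max 0 ((T - \<bar>x\<bar>) / (T - B))))"
  have cut: "continuous_on UNIV cut" "\<And>x. 0 \<le> cut x" "\<And>x. cut x \<le> 1"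
    "\<And>x. \<bar>x\<bar> \<ge> T \<Longrightarrow> cut x = 0" "\<And>x. x \<in> S \<Longrightarrow> cut x = 1"
    subgoal using assms unfolding cut_def by (intro continuous_intros) auto
    subgoal by (simp add: cut_def)
    subgoal by (simp add: cut_def)
    subgoal using assms by (simp add: cut_def divide_nonpos_pos max_absorb1)
    subgoal for x using assms subsetD[OF assms(2), of x] by (simp add: cut_def le_divide_eq_1 min_absorb1 max_absorb2 abs_le_iff)
    done
  define G where "G = (\<lambda>n x. cut x *\<^sub>R truncate M (g n x))"
  have contG: "continuous_on UNIV (G n)" for n
    unfolding G_def by (intro continuous_intros cut continuous_on_compose2[OF continuous_on_truncate[OF M, of UNIV] g]) auto
  have measG: "G n \<in> borel_measurable lebesgue" for n
    using borel_measurable_continuous_onI[OF contG[of n]] by (simp add: measurable_completion)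
  have G0: "G n x = 0" if "\<bar>x\<bar> \<ge> T" for n x using that by (simp add: G_def cut)
  have normG: "cmod (G n x) \<le> M" for n x
    using mult_mono[OF cut(3)[of x] norm_truncate_le[OF M, of "g n x"]] cut(2)[of x] by (simp add: G_def)
  define w where "w = (\<lambda>x. indicat_real {-T..T} x *\<^sub>R complex_of_real (2 * M))"
  have sqw: "square_integrable UNIV w"
    unfolding w_def by (subst square_integrable_extend) (use M in \<open>auto intro!: L2_norm_bounded(1)[where m = "2 * M"]\<close>)
  have f0_0: "f0 x = 0" if "\<bar>x\<bar> \<ge> T" for x
    using that assms(3) subsetD[OF assms(2), of x] by (auto simp: f0_def indicator_def)
  \<comment> \<open>At a fixed level, dominated convergence applies to the cut off continuous functions.\<close>
  have "(\<lambda>n. L2_norm UNIV (\<lambda>x. truncate M (f0 x) - G n x)) \<longlonglongrightarrow> 0"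
  proof (rule L2_norm_tendsto_0[OF _ sqw])
    show "(\<lambda>x. truncate M (f0 x) - G n x) \<in> borel_measurable (lebesgue_on UNIV)" for n
      using meas_trunc[of m] measG[of n] by (simp add: lebesgue_on_UNIV_eq M_def)
    have "(\<lambda>n. truncate M (f0 x) - G n x) \<longlonglongrightarrow> 0" if "x \<notin> N" for x
    proof -
      have "isCont (truncate M) (f0 x)"
        using continuous_on_truncate[OF M, of UNIV] by (simp add: continuous_on_eq_continuous_at)
      hence "(\<lambda>n. truncate M (g n x)) \<longlonglongrightarrow> truncate M (f0 x)"
        using lim[OF that] by (rule isCont_tendsto_compose)
      hence "(\<lambda>n. truncate M (f0 x) - G n x) \<longlonglongrightarrow> truncate M (f0 x) - cut x *\<^sub>R truncate M (f0 x)"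
        unfolding G_def by (intro tendsto_intros)
      moreover have "cut x *\<^sub>R truncate M (f0 x) = truncate M (f0 x)"
        by (cases "x \<in> S") (auto simp: cut f0_def truncate_def)
      ultimately show ?thesis by simp
    qed
    moreover have "N \<in> null_sets lebesgue" using N by (simp add: negligible_iff_null_sets)
    ultimately show "AE x in lebesgue_on UNIV. (\<lambda>n. truncate M (f0 x) - G n x) \<longlonglongrightarrow> 0"
      unfolding lebesgue_on_UNIV_eq by (intro AE_I'[of N]) auto
    show "cmod (truncate M (f0 x) - G n x) \<le> cmod (w x)" for n x
    proof (cases "\<bar>x\<bar> \<ge> T")
      case True
      thus ?thesis by (simp add: G0 f0_0 truncate_def)
    next
      case False
      have "cmod (truncate M (f0 x) - G n x) \<le> M + M"
        by (rule order_trans[OF norm_triangle_ineq4 add_mono[OF norm_truncate_le[OF M] normG]])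
      moreover have "x \<in> {-T..T}" using False by auto
      ultimately show ?thesis using M by (simp add: w_def)
    qed
  qed
  hence "\<forall>\<^sub>F n in sequentially. L2_norm UNIV (\<lambda>x. truncate M (f0 x) - G n x) < e / 2"
    using assms by (intro order_tendstoD) auto
  then obtain n where n: "L2_norm UNIV (\<lambda>x. truncate M (f0 x) - G n x) < e / 2"
    using eventually_happens'[OF sequentially_bot] by blast
  have sqG: "square_integrable UNIV (G n)"
  proof (rule square_integrable_mono[OF _ sqw])
    show "cmod (G n x) \<le> cmod (w x)" for x
      using normG[of n x] G0[of x n] M by (cases "\<bar>x\<bar> \<ge> T") (auto simp: w_def indicator_def)
  qed (use measG in \<open>simp add: lebesgue_on_UNIV_eq\<close>)
  have sqt: "square_integrable UNIV (\<lambda>x. f0 x - truncate M (f0 x))"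
    by (rule square_integrable_mono[OF _ sq0])
       (use m0 meas_trunc[of m] norm_diff_truncate_le[OF M] in \<open>auto simp: lebesgue_on_UNIV_eq M_def\<close>)
  have "square_integrable UNIV (\<lambda>x. f0 x - (f0 x - truncate M (f0 x)) - G n x)"
    by (intro square_integrable_diff sq0 sqt sqG)
  hence sqd: "square_integrable UNIV (\<lambda>x. truncate M (f0 x) - G n x)" by simp
  have "L2_norm UNIV (\<lambda>x. f0 x - G n x) < e"
    using L2_norm_triangle[OF sqt sqd] m n by (simp add: M_def)
  with that[of "G n"] contG[of n] G0[of _ n] sqG show ?thesis unfolding f0_def by blast
qed

section \<open>Gaussian quasi-interpolation\<close>

text \<open>
  The bound for the distance from \<open>1\<close> of a normalized sum of Gaussians of width \<open>1 / a\<close> over the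
  integers, that is, for how much quasi-interpolation of a constant can miss this constant.
\<close>
definition gauss_defect :: "real \<Rightarrow> real" where
  "gauss_defect a = 2 * exp (- (pi / a)\<^sup>2) / (1 - (exp (- (pi / a)\<^sup>2))\<^sup>2)"

text \<open>
  The value at \<open>t\<close> of the quasi-interpolant of the constant \<open>1\<close> with unit mesh: a theta
  function, written as a sum over the integers.
\<close>
definition gauss_theta :: "real \<Rightarrow> real \<Rightarrow> real" where
  "gauss_theta a t = (a / sqrt pi) * (\<Sum>\<^sub>\<infinity>n::int. exp (- (a * (of_int n - t))\<^sup>2))"

lemma gauss_theta_approx: "a > 0 \<Longrightarrow> \<bar>gauss_theta a t - 1\<bar> \<le> gauss_defect a"
  unfolding gauss_theta_def gauss_defect_def by (rule gauss_lattice_sum_approx)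

lemma gauss_theta_has_sum:
  assumes "a > 0"
  shows "((\<lambda>n::int. (a / sqrt pi) * exp (- (a * (of_int n - t))\<^sup>2)) has_sum gauss_theta a t) UNIV"
  unfolding gauss_theta_def
  by (intro has_sum_cmult_right has_sum_infsum summable_on_gauss_lattice assms)

lemma gauss_defect_mono:
  assumes "0 < a" "a \<le> b"
  shows "gauss_defect a \<le> gauss_defect b"
proof -
  define p q where "p = exp (- (pi / a)\<^sup>2)" and "q = exp (- (pi / b)\<^sup>2)"
  have "(pi / b)\<^sup>2 \<le> (pi / a)\<^sup>2"
    using assms by (intro power_mono divide_left_mono) auto
  hence pq: "0 < p" "p \<le> q" "q < 1" using assms by (auto simp: p_def q_def)
  hence "p\<^sup>2 \<le> q\<^sup>2" "q\<^sup>2 < 1" by (auto intro: power_mono simp: power_less_one_iff)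
  hence "2 * p / (1 - p\<^sup>2) \<le> 2 * q / (1 - q\<^sup>2)" using pq by (intro frac_le) auto
  thus ?thesis by (simp add: gauss_defect_def p_def q_def)
qed

text \<open>
  Nodes closer to \<open>x\<close> than \<open>\<eta>\<close> carry values that differ from \<open>v\<close> by at most \<open>\<omega>\<close>. At the
  remaining nodes half of the exponent of the Gaussian yields the factor
  \<open>exp (- (a \<eta> / h)\<^sup>2 / 2)\<close>, and the other half is again a Gaussian, of parameter
  \<open>a / sqrt 2\<close>, whose sum over all nodes is bounded. Since \<open>a / h\<close> is the shape parameter,
  this far part vanishes as the shape parameter tends to infinity.
\<close>
lemma quasi_interpolation_error:
  fixes s :: "int \<Rightarrow> complex"
  assumes "a > 0" "h > 0" "\<omega> \<ge> 0" "\<eta> > 0"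
    and zero: "\<And>n. n \<notin> {- int N..int N} \<Longrightarrow> s n = 0"
    and near: "\<And>n. \<bar>of_int n * h - x\<bar> < \<eta> \<Longrightarrow> cmod (s n - v) \<le> \<omega>"
    and bounded: "\<And>n. cmod (s n) \<le> K" "cmod v \<le> K"
  shows "cmod ((\<Sum>n\<in>{- int N..int N}. s n * of_real (a / sqrt pi * exp (- (a * (of_int n - x / h))\<^sup>2)))
            - v * of_real (gauss_theta a (x / h)))
      \<le> \<omega> * gauss_theta a (x / h)
        + 2 * K * sqrt 2 * exp (- (a * \<eta> / h)\<^sup>2 / 2) * gauss_theta (a / sqrt 2) (x / h)"
proof -
  define w where "w = (\<lambda>a n. a / sqrt pi * exp (- (a * (real_of_int n - x / h))\<^sup>2))"
  define E where "E = exp (- (a * \<eta> / h)\<^sup>2 / 2)"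
  have w0: "w a n \<ge> 0" if "a > 0" for a n using that by (simp add: w_def)
  have K0: "K \<ge> 0" using bounded(2) norm_ge_zero order_trans by blast
  have has_sum_w: "(w a has_sum gauss_theta a (x / h)) UNIV" if "a > 0" for a
    unfolding w_def by (rule gauss_theta_has_sum[OF that])
  have h1: "((\<lambda>n. s n * of_real (w a n)) has_sum (\<Sum>n\<in>{- int N..int N}. s n * of_real (w a n))) UNIV"
    by (rule has_sum_finite_neutralI) (use zero in auto)
  have h2: "((\<lambda>n. v * of_real (w a n)) has_sum v * of_real (gauss_theta a (x / h))) UNIV"
    by (intro has_sum_cmult_right has_sum_of_real has_sum_w assms)
  have 1: "((\<lambda>n. s n * of_real (w a n) - v * of_real (w a n)) has_sum
      ((\<Sum>n\<in>{- int N..int N}. s n * of_real (w a n)) - v * of_real (gauss_theta a (x / h)))) UNIV"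
    using has_sum_add[OF h1 has_sum_uminusI[OF h2]] by simp
  have 2: "((\<lambda>n. \<omega> * w a n + 2 * K * sqrt 2 * E * w (a / sqrt 2) n) has_sum
      (\<omega> * gauss_theta a (x / h) + 2 * K * sqrt 2 * E * gauss_theta (a / sqrt 2) (x / h))) UNIV"
    using assms by (intro has_sum_add has_sum_cmult_right has_sum_w) auto
  have "cmod ((\<Sum>n\<in>{- int N..int N}. s n * of_real (w a n)) - v * of_real (gauss_theta a (x / h)))
     \<le> \<omega> * gauss_theta a (x / h) + 2 * K * sqrt 2 * E * gauss_theta (a / sqrt 2) (x / h)"
  proof (rule norm_infsum_le[OF 1 2])
    fix n :: int
    have eq: "cmod (s n * of_real (w a n) - v * of_real (w a n)) = cmod (s n - v) * w a n"
      using w0[OF \<open>a > 0\<close>, of n] by (simp add: norm_mult flip: left_diff_distrib)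
    show "cmod (s n * of_real (w a n) - v * of_real (w a n)) \<le> \<omega> * w a n + 2 * K * sqrt 2 * E * w (a / sqrt 2) n"
    proof (cases "\<bar>of_int n * h - x\<bar> < \<eta>")
      case True
      have "cmod (s n - v) * w a n \<le> \<omega> * w a n"
        by (intro mult_right_mono near True w0 assms)
      moreover have "0 \<le> 2 * K * sqrt 2 * E * w (a / sqrt 2) n"
        using K0 assms by (intro mult_nonneg_nonneg w0) (auto simp: E_def)
      ultimately show ?thesis unfolding eq by linarith
    next
      case False
      define u where "u = a * (of_int n - x / h)"
      have "a * \<eta> / h \<le> a / h * \<bar>of_int n * h - x\<bar>"
        using False assms by (simp add: divide_right_mono)
      also have "of_int n * h - x = h * (of_int n - x / h)"
        using assms by (simp add: right_diff_distrib mult.commute)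
      also have "a / h * \<bar>h * (of_int n - x / h)\<bar> = \<bar>u\<bar>" using assms by (simp add: u_def abs_mult)
      finally have "(a * \<eta> / h)\<^sup>2 \<le> u\<^sup>2"
        using assms by (subst abs_le_square_iff[symmetric]) (simp add: abs_mult)
      hence e: "exp (- u\<^sup>2) \<le> E * exp (- (u\<^sup>2 / 2))"
        unfolding E_def by (simp flip: exp_add)
      have "w a n = sqrt 2 * (a / sqrt 2 / sqrt pi) * exp (- u\<^sup>2)" by (simp add: w_def u_def)
      also have "\<dots> \<le> sqrt 2 * (a / sqrt 2 / sqrt pi) * (E * exp (- (u\<^sup>2 / 2)))"
        using assms by (intro mult_left_mono e) auto
      also have "\<dots> = sqrt 2 * E * w (a / sqrt 2) n"
        by (simp add: w_def u_def power_mult_distrib power_divide)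
      finally have "w a n \<le> sqrt 2 * E * w (a / sqrt 2) n" .
      moreover have "cmod (s n - v) \<le> 2 * K"
        using norm_triangle_ineq4[of "s n" v] bounded(1)[of n] bounded(2) by linarith
      ultimately have "cmod (s n - v) * w a n \<le> 2 * K * (sqrt 2 * E * w (a / sqrt 2) n)"
        using w0[OF \<open>a > 0\<close>, of n] K0 by (intro mult_mono) auto
      moreover have "0 \<le> \<omega> * w a n" using assms w0 by simp
      ultimately show ?thesis unfolding eq by (simp add: mult.assoc)
    qed
  qed
  thus ?thesis by (simp add: w_def E_def)
qed

lemma compact_support_uniform_continuity:
  fixes g :: "real \<Rightarrow> 'a::real_normed_vector"
  assumes "continuous_on UNIV g" "\<And>x. \<bar>x\<bar> \<ge> T \<Longrightarrow> g x = 0" "T > 0" "\<omega> > 0"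
  obtains \<eta> where "\<eta> > 0" "\<And>x y. \<bar>x - y\<bar> < \<eta> \<Longrightarrow> norm (g x - g y) \<le> \<omega>"
proof -
  define c where "c = (\<lambda>x. max (-T) (min T x))"
  have gc: "g (c x) = g x" for x
    using assms(2)[of x] assms(2)[of T] assms(2)[of "-T"] assms(3)
    by (auto simp: c_def max_def min_def)
  have "uniformly_continuous_on {-T..T} g"
    by (intro compact_uniformly_continuous continuous_on_subset[OF assms(1)]) auto
  then obtain \<eta> where \<eta>: "\<eta> > 0" "\<And>x y. x \<in> {-T..T} \<Longrightarrow> y \<in> {-T..T} \<Longrightarrow> dist x y < \<eta> \<Longrightarrow> dist (g x) (g y) < \<omega>"
    unfolding uniformly_continuous_on_def using assms(4) by metis
  show ?thesis
  proof (rule that[OF \<eta>(1)])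
    fix x y :: real assume "\<bar>x - y\<bar> < \<eta>"
    moreover have "\<bar>c x - c y\<bar> \<le> \<bar>x - y\<bar>" by (auto simp: c_def max_def min_def abs_if)
    moreover have "c x \<in> {-T..T}" "c y \<in> {-T..T}" using assms(3) by (auto simp: c_def)
    ultimately have "dist (g (c x)) (g (c y)) < \<omega>" by (intro \<eta>(2)) (auto simp: dist_real_def)
    thus "norm (g x - g y) \<le> \<omega>" by (simp add: gc dist_norm)
  qed
qed

lemma compact_support_bounded:
  fixes g :: "real \<Rightarrow> 'a::real_normed_vector"
  assumes "continuous_on UNIV g" "\<And>x. \<bar>x\<bar> \<ge> T \<Longrightarrow> g x = 0"
  obtains K where "\<And>x. norm (g x) \<le> K"
proof -
  have "compact (g ` {-T..T})"
    by (intro compact_continuous_image continuous_on_subset[OF assms(1)]) auto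
  then obtain K where K: "K > 0" "\<And>y. y \<in> g ` {-T..T} \<Longrightarrow> norm y \<le> K"
    using compact_imp_bounded bounded_pos by metis
  show ?thesis
  proof (rule that[of K])
    fix x
    show "norm (g x) \<le> K"
    proof (cases "\<bar>x\<bar> \<ge> T")
      case False
      hence "x \<in> {-T..T}" by auto
      thus ?thesis using K(2) by blast
    qed (use assms(2) K(1) in simp)
  qed
qed

text \<open>
  Each of the \<open>2 N\<close> cells of \<open>[-T, T]\<close> is represented by its left end point; the node \<open>T\<close>
  has no cell of its own, which is harmless as \<open>\<phi>\<close> vanishes there.
\<close>
lemma riemann_sum_le:
  fixes \<phi> :: "real \<Rightarrow> real" and T :: real and N :: nat
  defines "h \<equiv> T / real N"
  assumes cont: "continuous_on UNIV \<phi>" and zero: "\<phi> T = 0" and "T > 0" "N \<ge> 1"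
    and osc: "\<And>x y. \<bar>x - y\<bar> \<le> h \<Longrightarrow> \<bar>\<phi> x - \<phi> y\<bar> \<le> \<omega>"
  shows "h * (\<Sum>n\<in>{- int N..int N}. \<phi> (of_int n * h)) \<le> integral {-T..T} \<phi> + 2 * T * \<omega>"
proof -
  have h: "h > 0" "real N * h = T" using assms(4,5) by (auto simp: h_def)
  have int: "\<phi> integrable_on {u..v}" for u v
    by (intro integrable_continuous_real continuous_on_subset[OF cont]) auto
  define F where "F = (\<lambda>k. integral {-T..(real k - real N) * h} \<phi>)"
  have cell: "h * \<phi> ((real k - real N) * h) \<le> F (Suc k) - F k + h * \<omega>" for k
  proof -
    let ?u = "(real k - real N) * h" and ?v = "(real (Suc k) - real N) * h"
    have uv: "?v = ?u + h" "-T \<le> ?u" using h by (auto simp: algebra_simps)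
    have "h * (\<phi> ?u - \<omega>) = integral {?u..?v} (\<lambda>_. \<phi> ?u - \<omega>)" using uv h by simp
    also have "\<dots> \<le> integral {?u..?v} \<phi>"
    proof (intro integral_le int)
      fix y assume "y \<in> {?u..?v}"
      hence "\<bar>?u - y\<bar> \<le> h" using uv by auto
      from osc[OF this] show "\<phi> ?u - \<omega> \<le> \<phi> y" by linarith
    qed auto
    also have "F k + integral {?u..?v} \<phi> = F (Suc k)"
      unfolding F_def using uv h by (intro Henstock_Kurzweil_Integration.integral_combine int) auto
    hence "integral {?u..?v} \<phi> = F (Suc k) - F k" by simp
    finally show ?thesis by (simp add: algebra_simps)
  qed
  have "(\<Sum>n\<in>{- int N..int N}. \<phi> (of_int n * h)) = (\<Sum>n\<in>{- int N..<int N}. \<phi> (of_int n * h))"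
    using zero h by (intro sum.mono_neutral_right) auto
  also have "\<dots> = (\<Sum>k<2 * N. \<phi> ((real k - real N) * h))"
    by (rule sum.reindex_bij_witness[of _ "\<lambda>k. int k - int N" "\<lambda>n. nat (n + int N)"]) auto
  finally have "h * (\<Sum>n\<in>{- int N..int N}. \<phi> (of_int n * h)) = (\<Sum>k<2 * N. h * \<phi> ((real k - real N) * h))"
    by (simp add: sum_distrib_left)
  also have "\<dots> \<le> (\<Sum>k<2 * N. F (Suc k) - F k + h * \<omega>)"
    by (intro sum_mono cell)
  also have "\<dots> = F (2 * N) - F 0 + 2 * (real N * h) * \<omega>"
    by (simp add: sum.distrib sum_lessThan_telescope)
  also have "F (2 * N) = integral {-T..T} \<phi>" using h by (simp add: F_def)
  also have "F 0 = 0" using h by (simp add: F_def)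
  finally show ?thesis using h by simp
qed

section \<open>The regularized approximation error\<close>

lemma reg_error_le:
  assumes "\<tau> \<ge> 0"
  shows "reg_error T \<Omega> \<tau> \<epsilon> N f \<le> L2_norm \<Omega> (\<lambda>x. f x - synthesis T \<epsilon> N z x) + \<tau> * coeff_norm N z"
  unfolding reg_error_def
proof (rule cINF_lower)
  show "bdd_below (range (\<lambda>z. L2_norm \<Omega> (\<lambda>x. f x - synthesis T \<epsilon> N z x) + \<tau> * coeff_norm N z))"
    using assms by (intro bdd_belowI[of _ 0]) (auto intro!: add_nonneg_nonneg simp: coeff_norm_def L2_set_nonneg)
qed auto

lemma reg_error_nonneg:
  assumes "\<tau> \<ge> 0"
  shows "reg_error T \<Omega> \<tau> \<epsilon> N f \<ge> 0"
  unfolding reg_error_def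
  using assms by (intro cINF_greatest) (auto intro!: add_nonneg_nonneg simp: coeff_norm_def L2_set_nonneg)

lemma reg_error_le_L2_norm:
  assumes "\<tau> \<ge> 0"
  shows "reg_error T \<Omega> \<tau> \<epsilon> N f \<le> L2_norm \<Omega> f"
  using reg_error_le[OF assms, of T \<Omega> \<epsilon> N f "\<lambda>_. 0"] by (simp add: synthesis_def coeff_norm_def L2_set_def)

text \<open>
  The scaling turns the synthesized function into the sum of \<open>g (n h)\<close> times
  \<open>a / sqrt pi * exp (- (a (n - x / h))\<^sup>2)\<close>, with \<open>h = T / N\<close> and \<open>a = \<epsilon> h\<close>, so that
  constants are nearly reproduced.
\<close>
definition quasi_coeffs :: "real \<Rightarrow> real \<Rightarrow> nat \<Rightarrow> (real \<Rightarrow> complex) \<Rightarrow> int \<Rightarrow> complex" where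
  "quasi_coeffs T \<epsilon> N g n = of_real (T / real N * sqrt \<epsilon> / sqrt pi) * g (of_int n * (T / real N))"

lemma synthesis_quasi_coeffs:
  assumes "T > 0" "\<epsilon> > 0" "N \<ge> 1"
  shows "synthesis T \<epsilon> N (quasi_coeffs T \<epsilon> N g) x =
    (\<Sum>n\<in>{- int N..int N}. g (of_int n * (T / real N)) *
       of_real (\<epsilon> * T / real N / sqrt pi * exp (- (\<epsilon> * T / real N * (of_int n - x / (T / real N)))\<^sup>2)))"
  unfolding synthesis_def
proof (rule sum.cong[OF refl])
  fix n :: int
  have sq: "(\<epsilon> * (x - of_int n * T / real N))\<^sup>2 = (\<epsilon> * T / real N * (of_int n - x / (T / real N)))\<^sup>2"
    using assms by (subst power2_eq_iff) (simp add: field_simps)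
  have factor: "T / real N * sqrt \<epsilon> / sqrt pi * sqrt \<epsilon> = \<epsilon> * T / real N / sqrt pi"
  proof -
    have "T / real N * sqrt \<epsilon> / sqrt pi * sqrt \<epsilon> = T / real N * (sqrt \<epsilon> * sqrt \<epsilon>) / sqrt pi"
      by simp
    also have "sqrt \<epsilon> * sqrt \<epsilon> = \<epsilon>" using assms by simp
    finally show ?thesis by (simp add: mult.commute)
  qed
  have regroup: "of_real A * y * of_real (r * e) = y * of_real (A * r * e)" for A r e :: real and y :: complex
    by (simp add: mult_ac)
  show "quasi_coeffs T \<epsilon> N g n * of_real (sqrt \<epsilon> * gauss_rbf (\<epsilon> * (x - of_int n * T / real N))) =
    g (of_int n * (T / real N)) *
       of_real (\<epsilon> * T / real N / sqrt pi * exp (- (\<epsilon> * T / real N * (of_int n - x / (T / real N)))\<^sup>2))"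
    unfolding quasi_coeffs_def gauss_rbf_def regroup sq factor ..
qed

text \<open>
  The squared norm is a Riemann sum for \<open>\<epsilon> T / (N \<pi>)\<close> times the squared norm of \<open>g\<close>. This is
  the source of the factor \<open>sqrt (\<epsilon> T / N)\<close> in front of \<open>\<tau>\<close>.
\<close>
lemma coeff_norm_quasi_coeffs:
  assumes "T > 0" "\<epsilon> > 0" "N \<ge> 1"
  shows "coeff_norm N (quasi_coeffs T \<epsilon> N g) =
    sqrt (\<epsilon> * T / real N / pi * (T / real N * (\<Sum>n\<in>{- int N..int N}. (cmod (g (of_int n * (T / real N))))\<^sup>2)))"
proof -
  have "(cmod (quasi_coeffs T \<epsilon> N g n))\<^sup>2 =
      \<epsilon> * T / real N / pi * (T / real N) * (cmod (g (of_int n * (T / real N))))\<^sup>2" for n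
  proof -
    have "(T / real N * sqrt \<epsilon> / sqrt pi)\<^sup>2 = \<epsilon> * T / real N / pi * (T / real N)"
      using assms by (simp add: power_mult_distrib power_divide) (simp add: power2_eq_square mult_ac)
    thus ?thesis unfolding quasi_coeffs_def norm_mult norm_of_real power_mult_distrib power2_abs by simp
  qed
  thus ?thesis unfolding coeff_norm_def L2_set_def by (simp add: sum_distrib_left mult.assoc)
qed

text \<open>
  The residual is split as \<open>(f - g) + (g - \<theta> g) + (\<theta> g - S g)\<close>, where \<open>S g\<close> is the
  quasi-interpolant and \<open>\<theta>\<close> the theta function: the first part is a matter of density, the
  second is at most \<open>D\<close> times the norm of \<open>g\<close>, and the third is uniformly small by continuity
  of \<open>g\<close>. The last summand of the bound is the penalty.
\<close>
lemma reg_error_quasi_interpolation: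
  fixes g :: "real \<Rightarrow> complex" and N :: nat
  assumes pos: "T > 0" "\<epsilon> > 0" "N \<ge> 1" "\<tau> \<ge> 0"
    and S: "\<Omega> \<in> sets lebesgue" "\<Omega> \<subseteq> {-T..T}" and f: "square_integrable \<Omega> f"
    and g: "continuous_on UNIV g" "\<And>x. \<bar>x\<bar> \<ge> T \<Longrightarrow> g x = 0" "square_integrable UNIV g" "\<And>x. cmod (g x) \<le> K"
    and \<omega>: "\<omega> \<ge> 0" "\<eta> > 0" "\<And>x y. \<bar>x - y\<bar> < \<eta> \<Longrightarrow> cmod (g x - g y) \<le> \<omega>"
    and \<omega>': "\<omega>' \<ge> 0" "\<And>x y. \<bar>x - y\<bar> \<le> T / real N \<Longrightarrow> \<bar>(cmod (g x))\<^sup>2 - (cmod (g y))\<^sup>2\<bar> \<le> \<omega>'"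
    and D: "gauss_defect (\<epsilon> * T / real N) \<le> D" and A: "\<epsilon> * T / real N \<le> A"
  shows "reg_error T \<Omega> \<tau> \<epsilon> N f \<le> L2_norm \<Omega> (\<lambda>x. f x - g x) + D * L2_norm \<Omega> g
     + (\<omega> + 2 * K * sqrt 2 * exp (- (\<epsilon> * \<eta>)\<^sup>2 / 2)) * (1 + D) * sqrt (2 * T)
     + \<tau> * sqrt A * (L2_norm UNIV g + sqrt (2 * T * \<omega>'))"
proof -
  define h where "h = T / real N"
  define a where "a = \<epsilon> * T / real N"
  define z where "z = quasi_coeffs T \<epsilon> N g"
  define m where "m = (\<omega> + 2 * K * sqrt 2 * exp (- (\<epsilon> * \<eta>)\<^sup>2 / 2)) * (1 + D)"
  have h: "h > 0" using pos by (simp add: h_def)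
  have a: "a > 0" "a / h = \<epsilon>" using pos by (auto simp: a_def h_def)
  have K: "K \<ge> 0" using g(4) norm_ge_zero order_trans by blast
  have theta: "\<bar>gauss_theta a t - 1\<bar> \<le> D" "gauss_theta a t \<le> 1 + D" "gauss_theta (a / sqrt 2) t \<le> 1 + D" for t
  proof -
    have "gauss_defect (a / sqrt 2) \<le> gauss_defect a"
      using a by (intro gauss_defect_mono) (auto simp: divide_le_eq)
    thus "\<bar>gauss_theta a t - 1\<bar> \<le> D" "gauss_theta a t \<le> 1 + D" "gauss_theta (a / sqrt 2) t \<le> 1 + D"
      using gauss_theta_approx[of a t] gauss_theta_approx[of "a / sqrt 2" t] D a unfolding a_def[symmetric] by auto
  qed
  have D0: "D \<ge> 0" using theta(1)[of 0] by linarith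
  have m0: "m \<ge> 0" unfolding m_def using \<omega> K D0 by (intro mult_nonneg_nonneg add_nonneg_nonneg) auto
  have pointwise: "cmod (g x - synthesis T \<epsilon> N z x) \<le> D * cmod (g x) + m" for x
  proof -
    let ?S = "synthesis T \<epsilon> N z x" and ?\<theta> = "gauss_theta a (x / h)"
    have "cmod (?S - g x * of_real ?\<theta>) \<le> \<omega> * ?\<theta> + 2 * K * sqrt 2 * exp (- (a * \<eta> / h)\<^sup>2 / 2) * gauss_theta (a / sqrt 2) (x / h)"
      unfolding z_def synthesis_quasi_coeffs[OF pos(1-3)] h_def[symmetric] a_def[symmetric]
    proof (rule quasi_interpolation_error[where s = "\<lambda>n. g (of_int n * h)"])
      fix n :: int assume "n \<notin> {- int N..int N}"
      hence "real N \<le> \<bar>real_of_int n\<bar>" by auto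
      hence "real N * h \<le> \<bar>real_of_int n\<bar> * h" using h by (intro mult_right_mono) auto
      hence "T \<le> \<bar>of_int n * h\<bar>" using pos h by (simp add: h_def abs_mult)
      thus "g (of_int n * h) = 0" by (rule g(2))
    qed (use a h \<omega> g in auto)
    also have "a * \<eta> / h = \<epsilon> * \<eta>" unfolding a(2)[symmetric] by simp
    also have "\<omega> * ?\<theta> + 2 * K * sqrt 2 * exp (- (\<epsilon> * \<eta>)\<^sup>2 / 2) * gauss_theta (a / sqrt 2) (x / h) \<le> m"
      unfolding m_def distrib_right using \<omega>(1) K theta by (intro add_mono mult_left_mono) auto
    finally have 1: "cmod (?S - g x * of_real ?\<theta>) \<le> m" .
    have "g x * of_real ?\<theta> - g x = g x * of_real (?\<theta> - 1)" by (simp add: algebra_simps)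
    hence "cmod (g x * of_real ?\<theta> - g x) = cmod (g x) * \<bar>?\<theta> - 1\<bar>" by (simp only: norm_mult norm_of_real)
    also have "\<dots> \<le> cmod (g x) * D" by (intro mult_left_mono theta) auto
    finally have 2: "cmod (g x * of_real ?\<theta> - g x) \<le> D * cmod (g x)" by (simp add: mult.commute)
    have "cmod (g x - ?S) = cmod ((?S - g x * of_real ?\<theta>) + (g x * of_real ?\<theta> - g x))"
      by (simp add: norm_minus_commute)
    also have "\<dots> \<le> m + D * cmod (g x)" by (rule norm_triangle_mono[OF 1 2])
    finally show ?thesis by simp
  qed
  have S': "\<Omega> \<in> lmeasurable"
    using S by (intro bounded_set_imp_lmeasurable bounded_subset[OF bounded_closed_interval])
  have measure_S: "measure lebesgue \<Omega> \<le> 2 * T"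
    using measure_mono_fmeasurable[of \<Omega> "{-T..T}" lebesgue] S pos by simp
  have cont_meas: "u \<in> borel_measurable (lebesgue_on \<Omega>)" if "continuous_on UNIV u" for u :: "real \<Rightarrow> complex"
    using continuous_imp_measurable_on_sets_lebesgue[OF continuous_on_subset[OF that] S(1)] by simp
  have cont_synth: "continuous_on UNIV (synthesis T \<epsilon> N z)"
    unfolding synthesis_def[abs_def] gauss_rbf_def by (intro continuous_intros)
  have g\<Omega>: "square_integrable \<Omega> g"
  proof -
    have "square_integrable UNIV (\<lambda>x. indicat_real \<Omega> x *\<^sub>R g x)"
      by (rule square_integrable_mono[OF _ g(3)])
         (use S cont_meas[OF g(1)] in \<open>auto simp: lebesgue_on_UNIV_eq borel_measurable_restrict_space_iff indicator_def\<close>)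
    thus ?thesis by (simp add: square_integrable_extend S)
  qed
  have dom: "square_integrable \<Omega> (\<lambda>x. of_real D * of_real (cmod (g x)) + of_real m)"
    "L2_norm \<Omega> (\<lambda>x. of_real D * of_real (cmod (g x)) + of_real m) \<le> D * L2_norm \<Omega> g + m * sqrt (2 * T)"
  proof -
    have sqg: "square_integrable \<Omega> (\<lambda>x. of_real D * of_real (cmod (g x)))"
      using g\<Omega> by (auto simp: square_integrable_def norm_mult power_mult_distrib)
    have m: "square_integrable \<Omega> (\<lambda>_. of_real m)" "L2_norm \<Omega> (\<lambda>_. of_real m) \<le> m * sqrt (measure lebesgue \<Omega>)"
      using m0 by (auto intro!: L2_norm_bounded[OF S', of _ m])
    show "square_integrable \<Omega> (\<lambda>x. of_real D * of_real (cmod (g x)) + of_real m)"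
      by (intro square_integrable_add sqg m)
    have "L2_norm \<Omega> (\<lambda>x. of_real (cmod (g x))) = L2_norm \<Omega> g" by (simp add: L2_norm_def)
    hence "L2_norm \<Omega> (\<lambda>x. of_real D * of_real (cmod (g x))) = D * L2_norm \<Omega> g"
      using D0 by (simp add: L2_norm_cmult)
    moreover have "m * sqrt (measure lebesgue \<Omega>) \<le> m * sqrt (2 * T)"
      using m0 measure_S by (intro mult_left_mono) auto
    ultimately show "L2_norm \<Omega> (\<lambda>x. of_real D * of_real (cmod (g x)) + of_real m) \<le> D * L2_norm \<Omega> g + m * sqrt (2 * T)"
      using L2_norm_triangle[OF sqg m(1)] m(2) by linarith
  qed
  have meas_diff: "(\<lambda>x. g x - synthesis T \<epsilon> N z x) \<in> borel_measurable (lebesgue_on \<Omega>)"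
    by (intro cont_meas continuous_intros g cont_synth)
  have le_dom: "cmod (g x - synthesis T \<epsilon> N z x) \<le> cmod (of_real D * of_real (cmod (g x)) + of_real m)" for x
    using pointwise[of x] m0 D0 by (simp flip: of_real_mult of_real_add)
  have sq_diff: "square_integrable \<Omega> (\<lambda>x. g x - synthesis T \<epsilon> N z x)"
    by (rule square_integrable_mono[OF meas_diff dom(1) le_dom])
  have "L2_norm \<Omega> (\<lambda>x. f x - synthesis T \<epsilon> N z x) \<le> L2_norm \<Omega> (\<lambda>x. f x - g x) + L2_norm \<Omega> (\<lambda>x. g x - synthesis T \<epsilon> N z x)"
    using L2_norm_triangle[OF square_integrable_diff[OF f g\<Omega>] sq_diff] by simp
  also have "L2_norm \<Omega> (\<lambda>x. g x - synthesis T \<epsilon> N z x) \<le> D * L2_norm \<Omega> g + m * sqrt (2 * T)"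
    by (rule order_trans[OF L2_norm_mono[OF meas_diff dom(1) le_dom] dom(2)])
  finally have approx: "L2_norm \<Omega> (\<lambda>x. f x - synthesis T \<epsilon> N z x)
      \<le> L2_norm \<Omega> (\<lambda>x. f x - g x) + D * L2_norm \<Omega> g + m * sqrt (2 * T)" by simp

  have coeff: "coeff_norm N z \<le> sqrt A * (L2_norm UNIV g + sqrt (2 * T * \<omega>'))"
  proof -
    let ?\<phi> = "\<lambda>x. (cmod (g x))\<^sup>2"
    have "h * (\<Sum>n\<in>{- int N..int N}. ?\<phi> (of_int n * h)) \<le> integral {-T..T} ?\<phi> + 2 * T * \<omega>'"
      unfolding h_def using pos \<omega>' g(2)[of T]
      by (intro riemann_sum_le continuous_intros g(1)) auto
    also have "integral {-T..T} ?\<phi> \<le> integral UNIV ?\<phi>"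
      using has_integral_integral_lebesgue[of ?\<phi>] g(3)
      by (intro integral_subset_le integrable_continuous_real continuous_intros continuous_on_subset[OF g(1)])
         (auto simp: square_integrable_def lebesgue_on_UNIV_eq integrable_on_def)
    also have "integral UNIV ?\<phi> = (L2_norm UNIV g)\<^sup>2"
      using has_integral_integral_lebesgue[of ?\<phi>] g(3)
      by (auto simp: L2_norm_power2 square_integrable_def lebesgue_on_UNIV_eq intro: integral_unique)
    finally have "h * (\<Sum>n\<in>{- int N..int N}. ?\<phi> (of_int n * h)) \<le> (L2_norm UNIV g)\<^sup>2 + 2 * T * \<omega>'" by simp
    moreover have "a / pi \<le> A"
    proof -
      have "a / pi \<le> a / 1" using a pi_gt3 by (intro divide_left_mono) auto
      thus ?thesis using A by (simp add: a_def)
    qed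
    ultimately have "coeff_norm N z \<le> sqrt (A * ((L2_norm UNIV g)\<^sup>2 + 2 * T * \<omega>'))"
      unfolding z_def coeff_norm_quasi_coeffs[OF pos(1-3)] h_def[symmetric] a_def[symmetric]
      using a h by (intro real_sqrt_le_mono mult_mono' mult_nonneg_nonneg sum_nonneg) auto
    also have "\<dots> = sqrt A * sqrt ((L2_norm UNIV g)\<^sup>2 + 2 * T * \<omega>')" by (rule real_sqrt_mult)
    also have "\<dots> \<le> sqrt A * (L2_norm UNIV g + sqrt (2 * T * \<omega>'))"
    proof (rule mult_left_mono)
      show "sqrt ((L2_norm UNIV g)\<^sup>2 + 2 * T * \<omega>') \<le> L2_norm UNIV g + sqrt (2 * T * \<omega>')"
        using sqrt_add_le_add_sqrt[of "(L2_norm UNIV g)\<^sup>2" "2 * T * \<omega>'"] pos \<omega>'(1) by simp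
    qed (use a A in \<open>auto simp: a_def\<close>)
    finally show ?thesis .
  qed
  have "reg_error T \<Omega> \<tau> \<epsilon> N f \<le> L2_norm \<Omega> (\<lambda>x. f x - synthesis T \<epsilon> N z x) + \<tau> * coeff_norm N z"
    by (rule reg_error_le[OF pos(4)])
  also have "\<dots> \<le> (L2_norm \<Omega> (\<lambda>x. f x - g x) + D * L2_norm \<Omega> g + m * sqrt (2 * T))
      + \<tau> * (sqrt A * (L2_norm UNIV g + sqrt (2 * T * \<omega>')))"
    using pos by (intro add_mono approx mult_left_mono coeff)
  finally show ?thesis unfolding m_def by (simp add: mult.assoc)
qed

text \<open>
  Both asymptotic regimes reduce to this estimate: \<open>D\<close> bounds the failure to reproduce
  constants and \<open>A\<close> the mesh ratio \<open>\<epsilon> T / N\<close>. The approximant \<open>g\<close> is fixed before \<open>N\<close>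
  tends to infinity, so its moduli of continuity may be as bad as they like.
\<close>
lemma reg_error_eventually_le:
  fixes \<epsilon> :: "nat \<Rightarrow> real"
  assumes pos: "T > 0" "\<tau> \<ge> 0" "\<And>N. N \<ge> 1 \<Longrightarrow> \<epsilon> N > 0"
    and S: "\<Omega> \<in> sets lebesgue" "\<Omega> \<subseteq> {-B..B}" "B < T" and f: "square_integrable \<Omega> f"
    and lim: "filterlim \<epsilon> at_top sequentially"
    and D: "D \<ge> 0" "\<forall>\<^sub>F N in sequentially. gauss_defect (\<epsilon> N * T / real N) \<le> D"
    and A: "A \<ge> 0" "\<forall>\<^sub>F N in sequentially. \<epsilon> N * T / real N \<le> A"
    and e: "e > 0"
  shows "\<forall>\<^sub>F N in sequentially. reg_error T \<Omega> \<tau> (\<epsilon> N) N f \<le> (D + \<tau> * sqrt A) * L2_norm \<Omega> f + e"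
proof -
  define c where "c = D + \<tau> * sqrt A"
  define F where "F = L2_norm \<Omega> f"
  \<comment> \<open>The error budget \<open>e\<close> is divided equally between the density error, the two moduli of continuity and the Gaussian tail.\<close>
  define \<delta> where "\<delta> = e / (4 * (1 + c))"
  define \<omega> where "\<omega> = e / (4 * (1 + D) * sqrt (2 * T))"
  define \<omega>' where "\<omega>' = (e / (4 * (1 + \<tau> * sqrt A)))\<^sup>2 / (2 * T)"
  have c: "c \<ge> 0" using D A pos by (simp add: c_def)
  have \<tau>A: "\<tau> * sqrt A \<ge> 0" using A pos by simp
  have \<delta>: "\<delta> > 0" using e c by (simp add: \<delta>_def)
  have \<omega>: "\<omega> > 0" using e D pos by (simp add: \<omega>_def)
  have \<omega>': "\<omega>' > 0" using e \<tau>A pos by (simp add: \<omega>'_def)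
  obtain g where g: "continuous_on UNIV g" "\<And>x. \<bar>x\<bar> \<ge> T \<Longrightarrow> g x = 0" "square_integrable UNIV g"
    "L2_norm UNIV (\<lambda>x. indicat_real \<Omega> x *\<^sub>R f x - g x) < \<delta>"
    using continuous_approx_L2[OF S f \<delta>] by metis
  obtain K where K: "\<And>x. cmod (g x) \<le> K" using compact_support_bounded[OF g(1,2)] by blast
  obtain \<eta> where \<eta>: "\<eta> > 0" "\<And>x y. \<bar>x - y\<bar> < \<eta> \<Longrightarrow> cmod (g x - g y) \<le> \<omega>"
    using compact_support_uniform_continuity[OF g(1,2) pos(1) \<omega>] by blast
  have "continuous_on UNIV (\<lambda>x. (cmod (g x))\<^sup>2)" by (intro continuous_intros g)
  then obtain \<eta>' where \<eta>': "\<eta>' > 0" "\<And>x y. \<bar>x - y\<bar> < \<eta>' \<Longrightarrow> norm ((cmod (g x))\<^sup>2 - (cmod (g y))\<^sup>2) \<le> \<omega>'"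
    by (rule compact_support_uniform_continuity[OF _ _ pos(1) \<omega>']) (use g(2) in auto)
  have S_T: "\<Omega> \<subseteq> {-T..T}" using S by auto
  have sq0: "square_integrable UNIV (\<lambda>x. indicat_real \<Omega> x *\<^sub>R f x)"
    using S f by (simp add: square_integrable_extend)
  have meas_ind: "(\<lambda>x. indicat_real \<Omega> x *\<^sub>R u x) \<in> borel_measurable (lebesgue_on UNIV)"
    if "square_integrable UNIV u" for u
    using that S by (auto simp: square_integrable_def lebesgue_on_UNIV_eq)
  have restrict_le: "L2_norm \<Omega> u \<le> L2_norm UNIV u" if "square_integrable UNIV u" for u
    unfolding L2_norm_extend[OF S(1), of u, symmetric]
    by (rule L2_norm_mono[OF meas_ind[OF that] that]) (auto simp: indicator_def)
  have fg: "L2_norm \<Omega> (\<lambda>x. f x - g x) \<le> \<delta>"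
  proof -
    have "L2_norm \<Omega> (\<lambda>x. f x - g x) = L2_norm \<Omega> (\<lambda>x. indicat_real \<Omega> x *\<^sub>R f x - g x)"
      unfolding L2_norm_def by (intro arg_cong[of _ _ sqrt] Bochner_Integration.integral_cong)
        (auto simp: space_restrict_space)
    also have "\<dots> \<le> \<delta>" using restrict_le[OF square_integrable_diff[OF sq0 g(3)]] g(4) by linarith
    finally show ?thesis .
  qed
  have gF: "L2_norm UNIV g \<le> F + \<delta>"
  proof -
    have "L2_norm UNIV g \<le> L2_norm UNIV (\<lambda>x. indicat_real \<Omega> x *\<^sub>R f x)
        + L2_norm UNIV (\<lambda>x. - (indicat_real \<Omega> x *\<^sub>R f x - g x))"
      using L2_norm_triangle[OF sq0 square_integrable_uminus[OF square_integrable_diff[OF sq0 g(3)]]] by simp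
    thus ?thesis using g(4) by (simp only: L2_norm_uminus L2_norm_extend[OF S(1)] F_def)
  qed
  have "(\<lambda>N. 2 * K * sqrt 2 * exp (- (\<epsilon> N * \<eta>)\<^sup>2 / 2) * (1 + D) * sqrt (2 * T)) \<longlonglongrightarrow> 0"
  proof -
    have "((\<lambda>x. 2 * K * sqrt 2 * exp (- (x * \<eta>)\<^sup>2 / 2) * (1 + D) * sqrt (2 * T)) \<longlongrightarrow> 0) at_top"
      using \<eta>(1) by real_asymp
    from filterlim_compose[OF this lim] show ?thesis .
  qed
  hence ev_tail: "\<forall>\<^sub>F N in sequentially. 2 * K * sqrt 2 * exp (- (\<epsilon> N * \<eta>)\<^sup>2 / 2) * (1 + D) * sqrt (2 * T) < e / 4"
    using e by (intro order_tendstoD) auto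
  have "(\<lambda>N. T / real N) \<longlonglongrightarrow> 0" by real_asymp
  hence ev_mesh: "\<forall>\<^sub>F N in sequentially. T / real N < \<eta>'" using \<eta>' by (intro order_tendstoD) auto
  show ?thesis
    using ev_tail ev_mesh D(2) A(2) eventually_ge_at_top[of 1]
  proof eventually_elim
    case (elim N)
    have "reg_error T \<Omega> \<tau> (\<epsilon> N) N f \<le> L2_norm \<Omega> (\<lambda>x. f x - g x) + D * L2_norm \<Omega> g
     + (\<omega> + 2 * K * sqrt 2 * exp (- (\<epsilon> N * \<eta>)\<^sup>2 / 2)) * (1 + D) * sqrt (2 * T)
     + \<tau> * sqrt A * (L2_norm UNIV g + sqrt (2 * T * \<omega>'))"
      by (rule reg_error_quasi_interpolation[OF pos(1) pos(3)[OF elim(5)] elim(5) pos(2) S(1) S_T f g(1-3) K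
            less_imp_le[OF \<omega>] \<eta> less_imp_le[OF \<omega>'] _ elim(3,4)])
         (use \<eta>'(2) elim(2) in force)+
    also have "\<dots> \<le> \<delta> + D * (F + \<delta>)
       + (\<omega> + 2 * K * sqrt 2 * exp (- (\<epsilon> N * \<eta>)\<^sup>2 / 2)) * (1 + D) * sqrt (2 * T)
       + \<tau> * sqrt A * ((F + \<delta>) + sqrt (2 * T * \<omega>'))"
    proof -
      have "D * L2_norm \<Omega> g \<le> D * (F + \<delta>)"
        using restrict_le[OF g(3)] gF D by (intro mult_left_mono) auto
      moreover have "\<tau> * sqrt A * (L2_norm UNIV g + sqrt (2 * T * \<omega>'))
          \<le> \<tau> * sqrt A * ((F + \<delta>) + sqrt (2 * T * \<omega>'))"
        using gF \<tau>A by (intro mult_left_mono) auto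
      ultimately show ?thesis using fg by linarith
    qed
    also have "\<dots> = c * F + (1 + c) * \<delta> + \<omega> * (1 + D) * sqrt (2 * T)
       + 2 * K * sqrt 2 * exp (- (\<epsilon> N * \<eta>)\<^sup>2 / 2) * (1 + D) * sqrt (2 * T)
       + \<tau> * sqrt A * sqrt (2 * T * \<omega>')"
      by (simp add: c_def algebra_simps)
    also have "(1 + c) * \<delta> = e / 4" using c by (simp add: \<delta>_def field_simps)
    also have "\<omega> * (1 + D) * sqrt (2 * T) = e / 4"
    proof -
      have "1 + D \<noteq> 0" "sqrt (2 * T) \<noteq> 0" using D pos by auto
      thus ?thesis unfolding \<omega>_def by (simp add: divide_simps)
    qed
    also have "\<tau> * sqrt A * sqrt (2 * T * \<omega>') \<le> e / 4"
    proof -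
      have "sqrt (2 * T * \<omega>') = e / (4 * (1 + \<tau> * sqrt A))"
        using pos e \<tau>A by (simp add: \<omega>'_def)
      hence "\<tau> * sqrt A * sqrt (2 * T * \<omega>') = (\<tau> * sqrt A / (1 + \<tau> * sqrt A)) * (e / 4)"
        by simp
      also have "\<dots> \<le> 1 * (e / 4)" using \<tau>A e by (intro mult_right_mono) auto
      finally show ?thesis by simp
    qed
    finally show ?case using elim(1) by (simp add: c_def F_def)
  qed
qed

section \<open>Asymptotic regimes\<close>

lemma le_upto_o1I:
  assumes "\<And>e. e > 0 \<Longrightarrow> \<forall>\<^sub>F N in sequentially. X N \<le> C * Y N + e"
  shows "le_upto_o1 C X Y"
  unfolding le_upto_o1_def
proof (intro exI[of _ "\<lambda>N. max 0 (X N - C * Y N)"] conjI allI impI)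
  have "(\<lambda>N. max 0 (X N - C * Y N)) \<longlonglongrightarrow> 0"
  proof (rule tendstoI)
    fix e :: real assume "e > 0"
    hence "\<forall>\<^sub>F N in sequentially. X N \<le> C * Y N + e / 2" by (intro assms) auto
    thus "\<forall>\<^sub>F N in sequentially. dist (max 0 (X N - C * Y N)) 0 < e"
      by eventually_elim (use \<open>e > 0\<close> in \<open>auto simp: dist_real_def\<close>)
  qed
  thus "(\<lambda>N. max 0 (X N - C * Y N)) \<in> o(\<lambda>_. 1)" by (intro smalloI_tendsto) auto
qed auto

lemma gauss_defect_tendsto_0: "(gauss_defect \<longlongrightarrow> 0) (at_right 0)"
  unfolding gauss_defect_def by real_asymp

lemma isCont_gauss_defect:
  assumes "a > 0"
  shows "isCont gauss_defect a"
proof -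
  have "exp (- (pi / a)\<^sup>2) < 1" using assms by simp
  hence "(exp (- (pi / a)\<^sup>2))\<^sup>2 < 1" by (simp add: power_less_one_iff)
  thus ?thesis unfolding gauss_defect_def using assms by (intro continuous_intros) auto
qed

text \<open>
  If the shape parameter grows more slowly than \<open>N\<close>, the mesh ratio tends to \<open>0\<close>. Then
  both the defect and the penalty vanish in the limit, as \<open>\<kappa>\<close> and \<open>\<kappa>\<^sup>2\<close> eventually bound
  the defect and the mesh ratio for every \<open>\<kappa> > 0\<close>.
\<close>
lemma reg_error_tendsto_0:
  fixes \<epsilon> :: "nat \<Rightarrow> real"
  assumes pos: "T > 0" "\<tau> \<ge> 0" "\<And>N. N \<ge> 1 \<Longrightarrow> \<epsilon> N > 0"
    and S: "\<Omega> \<in> sets lebesgue" "\<Omega> \<subseteq> {-B..B}" "B < T" and f: "square_integrable \<Omega> f"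
    and \<epsilon>: "filterlim \<epsilon> at_top sequentially" "(\<lambda>N. \<epsilon> N / real N) \<longlonglongrightarrow> 0"
  shows "(\<lambda>N. reg_error T \<Omega> \<tau> (\<epsilon> N) N f) \<longlonglongrightarrow> 0"
proof (rule tendstoI)
  fix e :: real assume e: "e > 0"
  define F where "F = L2_norm \<Omega> f"
  define \<kappa> where "\<kappa> = e / (4 * (1 + \<tau>) * (F + 1))"
  have F: "F \<ge> 0" by (simp add: F_def)
  have \<kappa>: "\<kappa> > 0" using e F pos by (simp add: \<kappa>_def)
  have lim: "(\<lambda>N. \<epsilon> N * T / real N) \<longlonglongrightarrow> 0"
    using tendsto_mult_right[OF \<epsilon>(2), of T] by simp
  have "filterlim (\<lambda>N. \<epsilon> N * T / real N) (at_right 0) sequentially"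
    unfolding filterlim_at
  proof (intro conjI lim)
    show "\<forall>\<^sub>F N in sequentially. \<epsilon> N * T / real N \<in> {0<..} \<and> \<epsilon> N * T / real N \<noteq> 0"
      using eventually_ge_at_top[of 1]
    proof eventually_elim
      case (elim N)
      thus ?case using pos(1) pos(3)[OF elim] by simp
    qed
  qed
  from filterlim_compose[OF gauss_defect_tendsto_0 this]
  have "\<forall>\<^sub>F N in sequentially. gauss_defect (\<epsilon> N * T / real N) < \<kappa>" using \<kappa> by (intro order_tendstoD)
  moreover have "\<forall>\<^sub>F N in sequentially. \<epsilon> N * T / real N < \<kappa>\<^sup>2" using \<kappa> lim by (intro order_tendstoD) auto
  ultimately have "\<forall>\<^sub>F N in sequentially. reg_error T \<Omega> \<tau> (\<epsilon> N) N f \<le> (\<kappa> + \<tau> * sqrt (\<kappa>\<^sup>2)) * L2_norm \<Omega> f + e / 2"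
    using \<kappa> e by (intro reg_error_eventually_le[OF pos S f \<epsilon>(1)]) (auto elim: eventually_mono)
  thus "\<forall>\<^sub>F N in sequentially. dist (reg_error T \<Omega> \<tau> (\<epsilon> N) N f) 0 < e"
  proof eventually_elim
    case (elim N)
    have "(\<kappa> + \<tau> * sqrt (\<kappa>\<^sup>2)) * F = \<kappa> * (1 + \<tau>) * F" using \<kappa> by (simp add: algebra_simps)
    also have "\<dots> = (F / (F + 1)) * (e / 4)"
    proof -
      have "1 + \<tau> \<noteq> 0" "F + 1 \<noteq> 0" using pos(2) F by auto
      thus ?thesis unfolding \<kappa>_def by (simp add: divide_simps) (simp add: algebra_simps)
    qed
    also have "\<dots> \<le> 1 * (e / 4)" using F e by (intro mult_right_mono) auto
    finally have "(\<kappa> + \<tau> * sqrt (\<kappa>\<^sup>2)) * F \<le> e / 4" by simp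
    thus ?case using elim e reg_error_nonneg[OF pos(2), of T \<Omega> "\<epsilon> N" N f] by (simp add: F_def dist_real_def)
  qed
qed

text \<open>
  With \<open>s = exp (- \<pi>\<^sup>2 / (2 a\<^sup>2))\<close> the defect is of order \<open>s\<^sup>2\<close>, whereas the right-hand side
  exceeds \<open>s\<close>. The inequality is strict so that it survives passing to nearby
  values of \<open>a\<close>.
\<close>
lemma gauss_defect_less:
  assumes "a > 0" "exp (pi\<^sup>2 / (2 * a\<^sup>2)) \<ge> 2"
  shows "gauss_defect a < 5 / sqrt (exp (pi\<^sup>2 / (2 * a\<^sup>2)) - 1)"
proof -
  define E where "E = exp (pi\<^sup>2 / (2 * a\<^sup>2))"
  define s where "s = 1 / E"
  have E: "E \<ge> 2" using assms by (simp add: E_def)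
  have s: "0 < s" "s \<le> 1/2" using E by (auto simp: s_def field_simps)
  have "exp (- (pi / a)\<^sup>2) = s\<^sup>2"
    by (simp add: s_def E_def power_divide exp_minus field_simps flip: exp_double)
  hence "gauss_defect a = 2 * s\<^sup>2 / (1 - (s\<^sup>2)\<^sup>2)" by (simp add: gauss_defect_def)
  also have "\<dots> \<le> 2 * s\<^sup>2 / (1 / 2)"
  proof (intro divide_left_mono)
    have "s\<^sup>2 \<le> (1/2)\<^sup>2" using s by (intro power_mono) auto
    hence "(s\<^sup>2)\<^sup>2 \<le> ((1/2)\<^sup>2)\<^sup>2" by (rule power_mono) simp
    thus "1 / 2 \<le> 1 - (s\<^sup>2)\<^sup>2" "0 < (1 - (s\<^sup>2)\<^sup>2) * (1 / 2)" by (auto simp: power2_eq_square)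
  qed auto
  also have "2 * s\<^sup>2 / (1 / 2) \<le> 2 * s"
    using s by (simp add: power2_eq_square)
  also have "2 * s < 5 * s" using s by simp
  also have "5 * s \<le> 5 / sqrt (E - 1)"
  proof -
    have "sqrt (E - 1) \<le> sqrt (E\<^sup>2)"
      using E by (intro real_sqrt_le_mono) (simp add: power2_eq_square mult_le_cancel_left1 order_trans[of _ "E * 1"])
    hence "sqrt (E - 1) \<le> E" using E by simp
    thus ?thesis using E by (auto simp: s_def intro!: divide_left_mono)
  qed
  finally show ?thesis by (simp add: E_def)
qed

text \<open>
  If \<open>c T\<close> is small, the mesh ratio converges to \<open>c T\<close> and the defect there has the required
  size. If \<open>c T\<close> is large, the first summand of the factor is at least \<open>1\<close> and the
  zero vector of coefficients suffices, as its error is the norm of \<open>f\<close>.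
\<close>
lemma reg_error_critical_rate:
  fixes \<epsilon> :: "nat \<Rightarrow> real"
  assumes pos: "T > 0" "\<tau> \<ge> 0" "\<And>N. N \<ge> 1 \<Longrightarrow> \<epsilon> N > 0"
    and S: "\<Omega> \<in> sets lebesgue" "\<Omega> \<subseteq> {-B..B}" "B < T" and f: "square_integrable \<Omega> f"
    and c: "c > 0" and \<epsilon>: "(\<lambda>N. \<epsilon> N / (c * real N)) \<longlonglongrightarrow> 1" and e: "e > 0"
  shows "\<forall>\<^sub>F N in sequentially. reg_error T \<Omega> \<tau> (\<epsilon> N) N f
    \<le> 5 * (1 / sqrt (exp (pi\<^sup>2 / (2 * c\<^sup>2 * T\<^sup>2)) - 1) + sqrt (c * T) * \<tau>) * L2_norm \<Omega> f + e"
proof -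
  define X where "X = 1 / sqrt (exp (pi\<^sup>2 / (2 * c\<^sup>2 * T\<^sup>2)) - 1)"
  define F where "F = L2_norm \<Omega> f"
  have F: "F \<ge> 0" by (simp add: F_def)
  have X: "X > 0" using c pos by (simp add: X_def)
  have cT: "c * T > 0" using c pos by simp
  show ?thesis
  proof (cases "exp (pi\<^sup>2 / (2 * (c * T)\<^sup>2)) \<ge> 2")
    case True
    have "filterlim (\<lambda>N. (\<epsilon> N / (c * real N)) * (c * real N)) at_top sequentially"
      by (rule filterlim_tendsto_pos_mult_at_top[OF \<epsilon>]) (use c in \<open>auto, real_asymp\<close>)
    moreover have "\<forall>\<^sub>F N in sequentially. (\<epsilon> N / (c * real N)) * (c * real N) = \<epsilon> N"
      using eventually_gt_at_top[of 0] by eventually_elim (use c in auto)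
    ultimately have lim_top: "filterlim \<epsilon> at_top sequentially"
      by (rule filterlim_mono_eventually[OF _ order_refl order_refl])
    have "(\<lambda>N. (\<epsilon> N / (c * real N)) * (c * T)) \<longlonglongrightarrow> 1 * (c * T)" by (intro tendsto_intros \<epsilon>)
    also have "(\<lambda>N. (\<epsilon> N / (c * real N)) * (c * T)) = (\<lambda>N. \<epsilon> N * T / real N)" using c by (simp add: fun_eq_iff)
    finally have lim: "(\<lambda>N. \<epsilon> N * T / real N) \<longlonglongrightarrow> c * T" by simp
    have "(\<lambda>N. gauss_defect (\<epsilon> N * T / real N)) \<longlonglongrightarrow> gauss_defect (c * T)"
      by (rule isCont_tendsto_compose[OF isCont_gauss_defect[OF cT] lim])
    moreover have "gauss_defect (c * T) < 5 * X"
      using gauss_defect_less[OF cT True] by (simp add: X_def power_mult_distrib mult.assoc)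
    ultimately have "\<forall>\<^sub>F N in sequentially. gauss_defect (\<epsilon> N * T / real N) < 5 * X" by (rule order_tendstoD)
    hence defect: "\<forall>\<^sub>F N in sequentially. gauss_defect (\<epsilon> N * T / real N) \<le> 5 * X" by (auto elim: eventually_mono)
    have "\<forall>\<^sub>F N in sequentially. \<epsilon> N * T / real N < 4 * (c * T)"
      using cT by (intro order_tendstoD(2)[OF lim]) linarith
    hence "\<forall>\<^sub>F N in sequentially. \<epsilon> N * T / real N \<le> 4 * (c * T)" by (auto elim: eventually_mono)
    hence "\<forall>\<^sub>F N in sequentially. reg_error T \<Omega> \<tau> (\<epsilon> N) N f \<le> (5 * X + \<tau> * sqrt (4 * (c * T))) * F + e"
      unfolding F_def using cT X by (intro reg_error_eventually_le[OF pos S f lim_top _ defect] e) auto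
    moreover have "(5 * X + \<tau> * sqrt (4 * (c * T))) * F \<le> 5 * (X + sqrt (c * T) * \<tau>) * F"
    proof (rule mult_right_mono[OF _ F])
      have "sqrt (4 * (c * T)) = 2 * sqrt (c * T)" using real_sqrt_mult[of 4 "c * T"] by simp
      moreover have "0 \<le> sqrt (c * T) * \<tau>" using cT pos(2) by simp
      ultimately show "5 * X + \<tau> * sqrt (4 * (c * T)) \<le> 5 * (X + sqrt (c * T) * \<tau>)"
        by (simp add: algebra_simps)
    qed
    ultimately show ?thesis unfolding X_def[symmetric] F_def[symmetric]
      by (auto elim: eventually_mono)
  next
    case False
    hence "exp (pi\<^sup>2 / (2 * c\<^sup>2 * T\<^sup>2)) - 1 < 1" by (simp add: power_mult_distrib mult.assoc)
    hence "sqrt (exp (pi\<^sup>2 / (2 * c\<^sup>2 * T\<^sup>2)) - 1) \<le> 1" by simp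
    hence "X \<ge> 1" using X by (simp add: X_def)
    hence "1 * F \<le> 5 * (X + sqrt (c * T) * \<tau>) * F"
      using pos cT F by (intro mult_right_mono) (auto intro: order_trans[of _ "5 * X"])
    moreover have "reg_error T \<Omega> \<tau> (\<epsilon> N) N f \<le> F" for N
      unfolding F_def by (rule reg_error_le_L2_norm[OF pos(2)])
    ultimately show ?thesis unfolding X_def[symmetric] F_def[symmetric]
      using e by (intro always_eventually allI) (smt (verit))
  qed
qed

text \<open>
  The assumption on \<open>c T\<close> is equivalent to \<open>exp (\<pi>\<^sup>2 / (2 c\<^sup>2 T\<^sup>2)) \<ge> 1 + 1 / \<tau>\<^sup>2\<close>. The bound
  on \<open>\<tau>\<close> makes the logarithm at least \<open>1\<close> and hence \<open>c T\<close> at most \<open>\<pi>\<close>.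
\<close>
lemma small_ratio_bounds:
  fixes c T \<tau> :: real
  assumes "c > 0" "T > 0" "\<tau> > 0" "\<tau> < 1 / 2" and le: "c * T \<le> pi / sqrt (2 * ln (1 + 1 / \<tau>\<^sup>2))"
  shows "1 / sqrt (exp (pi\<^sup>2 / (2 * c\<^sup>2 * T\<^sup>2)) - 1) \<le> \<tau>" "sqrt (c * T) \<le> 2"
proof -
  define L where "L = ln (1 + 1 / \<tau>\<^sup>2)"
  have "\<tau>\<^sup>2 \<le> (1/2)\<^sup>2" using assms by (intro power_mono) auto
  hence "4 \<le> 1 / \<tau>\<^sup>2" using assms by (simp add: power2_eq_square field_simps)
  hence "exp 1 \<le> 1 + 1 / \<tau>\<^sup>2" using exp_le by linarith
  hence L1: "L \<ge> 1" unfolding L_def by (subst ln_ge_iff) (auto intro: add_pos_nonneg)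
  have expL: "exp L = 1 + 1 / \<tau>\<^sup>2" unfolding L_def by (subst exp_ln) (auto intro: add_pos_nonneg)
  have cT: "c * T > 0" using assms by simp
  have le': "c * T * sqrt (2 * L) \<le> pi" using le L1 unfolding L_def[symmetric] by (simp add: field_simps)
  have "(c * T * sqrt (2 * L))\<^sup>2 \<le> pi\<^sup>2" using cT L1 by (intro power_mono le') auto
  hence "(c * T)\<^sup>2 * (2 * L) \<le> pi\<^sup>2" using L1 by (simp add: power_mult_distrib)
  hence "L \<le> pi\<^sup>2 / (2 * c\<^sup>2 * T\<^sup>2)" using assms by (simp add: field_simps power_mult_distrib)
  hence "1 + 1 / \<tau>\<^sup>2 \<le> exp (pi\<^sup>2 / (2 * c\<^sup>2 * T\<^sup>2))" unfolding expL[symmetric] by simp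
  hence "sqrt (1 / \<tau>\<^sup>2) \<le> sqrt (exp (pi\<^sup>2 / (2 * c\<^sup>2 * T\<^sup>2)) - 1)" by (intro real_sqrt_le_mono) auto
  hence "1 / \<tau> \<le> sqrt (exp (pi\<^sup>2 / (2 * c\<^sup>2 * T\<^sup>2)) - 1)" using assms by (simp add: real_sqrt_divide)
  hence "1 / sqrt (exp (pi\<^sup>2 / (2 * c\<^sup>2 * T\<^sup>2)) - 1) \<le> 1 / (1 / \<tau>)"
    using assms by (intro divide_left_mono) (auto intro!: mult_pos_pos)
  thus "1 / sqrt (exp (pi\<^sup>2 / (2 * c\<^sup>2 * T\<^sup>2)) - 1) \<le> \<tau>" by simp
  have "c * T * 1 \<le> c * T * sqrt (2 * L)" using cT L1 by (intro mult_left_mono) auto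
  hence "c * T \<le> 4" using le' pi_less_4 by linarith
  hence "sqrt (c * T) \<le> sqrt 4" by (rule real_sqrt_le_mono)
  thus "sqrt (c * T) \<le> 2" by simp
qed

theorem theorem7:
  shows "\<exists>C::real. C > 0 \<and>
    (\<forall>(T::real) (\<Omega>::real set) (\<tau>::real) (\<epsilon>::nat \<Rightarrow> real) (f::real \<Rightarrow> complex).
       T > 0 \<and> \<Omega> \<in> sets lebesgue \<and> emeasure lebesgue \<Omega> > 0 \<and>
       \<Omega> \<subseteq> {-T<..<T} \<and> (SUP x\<in>\<Omega>. \<bar>x\<bar>) < T \<and>
       \<tau> > 0 \<and> (\<forall>N\<ge>1. \<epsilon> N > 0) \<and> square_integrable \<Omega> f \<longrightarrow>
       (\<forall>(c::real) (\<alpha>::real).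
          0 < \<alpha> \<and> \<alpha> < 1 \<and> c > 0 \<and>
          (\<lambda>N. \<epsilon> N / (c * real N powr \<alpha>)) \<longlonglongrightarrow> 1 \<longrightarrow>
          le_upto_o1 C
            (\<lambda>N. reg_error T \<Omega> \<tau> (\<epsilon> N) N f)
            (\<lambda>N. \<tau> * sqrt (T * \<epsilon> N / real N) * exp (pi\<^sup>2 / (4 * T\<^sup>2)) * L2_norm \<Omega> f) \<and>
          (\<lambda>N. reg_error T \<Omega> \<tau> (\<epsilon> N) N f) \<longlonglongrightarrow> 0) \<and>
       (\<forall>c::real.
          c > 0 \<and> (\<lambda>N. \<epsilon> N / (c * real N)) \<longlonglongrightarrow> 1 \<longrightarrow>
          le_upto_o1 C
            (\<lambda>N. reg_error T \<Omega> \<tau> (\<epsilon> N) N f)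
            (\<lambda>N. (1 / sqrt (exp (pi\<^sup>2 / (2 * c\<^sup>2 * T\<^sup>2)) - 1) + sqrt (c * T) * \<tau>)
                  * exp (pi\<^sup>2 / (4 * T\<^sup>2)) * L2_norm \<Omega> f) \<and>
          (\<tau> < 1 / 2 \<and> c * T \<le> pi / sqrt (2 * ln (1 + 1 / \<tau>\<^sup>2)) \<longrightarrow>
           le_upto_o1 C
            (\<lambda>N. reg_error T \<Omega> \<tau> (\<epsilon> N) N f)
            (\<lambda>N. \<tau> * exp (pi\<^sup>2 / (4 * T\<^sup>2)) * L2_norm \<Omega> f))))"
  \<comment> \<open>The constant is \<open>5 (1 + 2)\<close>: the factor \<open>5\<close> from the critical rate, and \<open>1 + 2\<close> from replacing both of its summands by multiples of \<open>\<tau>\<close>.\<close>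
proof (intro exI[of _ 15] conjI allI impI)
  fix T \<tau> :: real and \<Omega> :: "real set" and \<epsilon> :: "nat \<Rightarrow> real" and f :: "real \<Rightarrow> complex"
  assume H: "T > 0 \<and> \<Omega> \<in> sets lebesgue \<and> emeasure lebesgue \<Omega> > 0 \<and>
       \<Omega> \<subseteq> {-T<..<T} \<and> (SUP x\<in>\<Omega>. \<bar>x\<bar>) < T \<and>
       \<tau> > 0 \<and> (\<forall>N\<ge>1. \<epsilon> N > 0) \<and> square_integrable \<Omega> f"
  define B where "B = (SUP x\<in>\<Omega>. \<bar>x\<bar>)"
  \<comment> \<open>The exponential factor is at least \<open>1\<close>, so bounds by the norm of \<open>f\<close> imply bounds by \<open>F\<close>.\<close>
  define F where "F = exp (pi\<^sup>2 / (4 * T\<^sup>2)) * L2_norm \<Omega> f"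
  have "bdd_above (abs ` \<Omega>)" using H by (intro bdd_aboveI2[of _ _ T]) (auto simp: abs_le_iff dest: subsetD)
  hence "\<bar>x\<bar> \<le> B" if "x \<in> \<Omega>" for x unfolding B_def using that by (intro cSUP_upper)
  hence S: "\<Omega> \<in> sets lebesgue" "\<Omega> \<subseteq> {-B..B}" "B < T" using H by (auto simp: B_def abs_le_iff)
       (fastforce simp: B_def abs_le_iff)+
  have pos: "T > 0" "\<tau> \<ge> 0" "\<And>N. N \<ge> 1 \<Longrightarrow> \<epsilon> N > 0" and f: "square_integrable \<Omega> f" and \<tau>: "\<tau> > 0"
    using H by auto
  have "1 * L2_norm \<Omega> f \<le> F" unfolding F_def by (intro mult_right_mono) auto
  moreover have "F \<ge> 0" by (simp add: F_def)
  ultimately have F: "L2_norm \<Omega> f \<le> F" "F \<ge> 0" by auto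

  {
    fix c \<alpha> :: real
    assume c\<alpha>: "0 < \<alpha> \<and> \<alpha> < 1 \<and> c > 0 \<and> (\<lambda>N. \<epsilon> N / (c * real N powr \<alpha>)) \<longlonglongrightarrow> 1"
    hence lim1: "(\<lambda>N. \<epsilon> N / (c * real N powr \<alpha>)) \<longlonglongrightarrow> 1" by simp
    have "filterlim (\<lambda>N. (\<epsilon> N / (c * real N powr \<alpha>)) * (c * real N powr \<alpha>)) at_top sequentially"
      by (rule filterlim_tendsto_pos_mult_at_top[OF lim1]) (use c\<alpha> in \<open>auto, real_asymp\<close>)
    moreover have "\<forall>\<^sub>F N in sequentially. (\<epsilon> N / (c * real N powr \<alpha>)) * (c * real N powr \<alpha>) = \<epsilon> N"
      using eventually_gt_at_top[of 0] by eventually_elim (use c\<alpha> in auto)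
    ultimately have lim_top: "filterlim \<epsilon> at_top sequentially"
      by (rule filterlim_mono_eventually[OF _ order_refl order_refl])
    have "(\<lambda>N. c * real N powr \<alpha> / real N) \<longlonglongrightarrow> 0" using c\<alpha> by real_asymp
    hence "(\<lambda>N. (\<epsilon> N / (c * real N powr \<alpha>)) * (c * real N powr \<alpha> / real N)) \<longlonglongrightarrow> 1 * 0"
      by (intro tendsto_mult lim1)
    moreover have "\<forall>\<^sub>F N in sequentially. (\<epsilon> N / (c * real N powr \<alpha>)) * (c * real N powr \<alpha> / real N) = \<epsilon> N / real N"
      using eventually_gt_at_top[of 0] by eventually_elim (use c\<alpha> in auto)
    ultimately have lim0: "(\<lambda>N. \<epsilon> N / real N) \<longlonglongrightarrow> 0"
      using Lim_transform_eventually by fastforce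
    show lim: "(\<lambda>N. reg_error T \<Omega> \<tau> (\<epsilon> N) N f) \<longlonglongrightarrow> 0"
      by (rule reg_error_tendsto_0[OF pos S f lim_top lim0])
    show "le_upto_o1 15 (\<lambda>N. reg_error T \<Omega> \<tau> (\<epsilon> N) N f)
            (\<lambda>N. \<tau> * sqrt (T * \<epsilon> N / real N) * exp (pi\<^sup>2 / (4 * T\<^sup>2)) * L2_norm \<Omega> f)"
    proof (rule le_upto_o1I)
      fix e :: real assume "e > 0"
      hence "\<forall>\<^sub>F N in sequentially. reg_error T \<Omega> \<tau> (\<epsilon> N) N f < e" by (intro order_tendstoD[OF lim])
      thus "\<forall>\<^sub>F N in sequentially. reg_error T \<Omega> \<tau> (\<epsilon> N) N f
          \<le> 15 * (\<tau> * sqrt (T * \<epsilon> N / real N) * exp (pi\<^sup>2 / (4 * T\<^sup>2)) * L2_norm \<Omega> f) + e"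
        using eventually_ge_at_top[of 1]
      proof eventually_elim
        case (elim N)
        have "0 \<le> 15 * (\<tau> * sqrt (T * \<epsilon> N / real N) * exp (pi\<^sup>2 / (4 * T\<^sup>2)) * L2_norm \<Omega> f)"
          using pos(1,2) pos(3)[OF elim(2)] by simp
        thus ?case using elim(1) by linarith
      qed
    qed
  }

  fix c :: real
  assume c: "c > 0 \<and> (\<lambda>N. \<epsilon> N / (c * real N)) \<longlonglongrightarrow> 1"
  define Y where "Y = 1 / sqrt (exp (pi\<^sup>2 / (2 * c\<^sup>2 * T\<^sup>2)) - 1) + sqrt (c * T) * \<tau>"
  have Y: "Y \<ge> 0" unfolding Y_def using c pos by simp
  have main: "\<forall>\<^sub>F N in sequentially. reg_error T \<Omega> \<tau> (\<epsilon> N) N f \<le> 5 * Y * F + e" if "e > 0" for e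
  proof -
    have "5 * Y * L2_norm \<Omega> f \<le> 5 * Y * F" using Y F by (intro mult_left_mono) auto
    thus ?thesis using reg_error_critical_rate[OF pos S f conjunct1[OF c] conjunct2[OF c] that]
      unfolding Y_def[symmetric] by (auto elim: eventually_mono)
  qed
  show "le_upto_o1 15 (\<lambda>N. reg_error T \<Omega> \<tau> (\<epsilon> N) N f)
            (\<lambda>N. (1 / sqrt (exp (pi\<^sup>2 / (2 * c\<^sup>2 * T\<^sup>2)) - 1) + sqrt (c * T) * \<tau>)
                  * exp (pi\<^sup>2 / (4 * T\<^sup>2)) * L2_norm \<Omega> f)"
  proof (rule le_upto_o1I)
    fix e :: real assume "e > 0"
    have le: "5 * Y * F \<le> 15 * (Y * exp (pi\<^sup>2 / (4 * T\<^sup>2)) * L2_norm \<Omega> f)"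
    proof -
      have "Y * exp (pi\<^sup>2 / (4 * T\<^sup>2)) * L2_norm \<Omega> f = Y * F" by (simp add: F_def mult.assoc)
      thus ?thesis using mult_nonneg_nonneg[OF Y F(2)] by linarith
    qed
    show "\<forall>\<^sub>F N in sequentially. reg_error T \<Omega> \<tau> (\<epsilon> N) N f
          \<le> 15 * ((1 / sqrt (exp (pi\<^sup>2 / (2 * c\<^sup>2 * T\<^sup>2)) - 1) + sqrt (c * T) * \<tau>)
                  * exp (pi\<^sup>2 / (4 * T\<^sup>2)) * L2_norm \<Omega> f) + e"
      using main[OF \<open>e > 0\<close>] unfolding Y_def[symmetric] by (rule eventually_mono) (use le in linarith)
  qed
  assume small: "\<tau> < 1 / 2 \<and> c * T \<le> pi / sqrt (2 * ln (1 + 1 / \<tau>\<^sup>2))"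
  show "le_upto_o1 15 (\<lambda>N. reg_error T \<Omega> \<tau> (\<epsilon> N) N f)
            (\<lambda>N. \<tau> * exp (pi\<^sup>2 / (4 * T\<^sup>2)) * L2_norm \<Omega> f)"
  proof (rule le_upto_o1I)
    fix e :: real assume "e > 0"
    have "sqrt (c * T) * \<tau> \<le> 2 * \<tau>"
      using small_ratio_bounds(2)[OF conjunct1[OF c] pos(1) \<tau>] small \<tau> by (intro mult_right_mono) auto
    hence "Y \<le> 3 * \<tau>"
      using small_ratio_bounds(1)[OF conjunct1[OF c] pos(1) \<tau>] small unfolding Y_def by linarith
    hence "5 * Y * F \<le> 5 * (3 * \<tau>) * F" using F by (intro mult_right_mono) auto
    hence le: "5 * Y * F \<le> 15 * (\<tau> * exp (pi\<^sup>2 / (4 * T\<^sup>2)) * L2_norm \<Omega> f)" by (simp add: F_def mult.assoc)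
    show "\<forall>\<^sub>F N in sequentially. reg_error T \<Omega> \<tau> (\<epsilon> N) N f
          \<le> 15 * (\<tau> * exp (pi\<^sup>2 / (4 * T\<^sup>2)) * L2_norm \<Omega> f) + e"
      using main[OF \<open>e > 0\<close>] by (rule eventually_mono) (use le in linarith)
  qed
qed simp

end
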